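(* Let $P$ be a patch of $K$ which is simply connected and chain-connected. Then the only cell-preserving automorphism of $P$ is the identity map.
   Context: $K$ is the decorated combinatorial tiling: a 2-dimensional CW-complex homeomorphic to the open disk, built as follows. A decorated pentagon has boundary vertices $v_1,\dots,v_5$ in cyclic order (indices mod 5) with corner labels $1,\dots,5$, corner $v_i$ labelled $i$. The rule $\omega$ adds a vertex $m_i$ inside each edge $v_iv_{i+1}$, interior vertices $c_1,\dots,c_5$, edges $c_ic_{i+1}$, $c_im_i$, and replaces the face by the central pentagon $c_1\cdots c_5$ (label $i+1$ at $c_i$) and petals $v_i\,m_i\,c_i\,c_{i-1}\,m_{i-1}$ with labels $i,i+1,i+2,i+3,i+4$ (mod 5) at these corners. $K_0$ is one decorated pentagon, $K_n=\omega^n(K_0)$, $K_n$ embeds label-preservingly onto the central superpentagon $\omega^n(\text{central face of }\omega(K_0))$ of $K_{n+1}$, and $K$ is the direct limit. Automorphisms are cell-preserving and preserve corner labels. A patch is a finite subcomplex that is a union of faces (with their edges and vertices); chain-connected means any two faces are joined by a finite chain of its faces, consecutive ones sharing an edge. *)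

theory Defs
  imports "HOL-Analysis.Analysis" "HOL-Library.Multiset"
begin

text \<open>Concrete model of the decorated combinatorial tiling K.

  Corner labels are taken modulo 5: label i (1..5) is represented by the residue i mod 5
  (so label 5 is represented by 0).

  The direct limit K is modelled as the union of the nested complexes omega^n(T_n), where
  T_n is a decorated pentagon ("superpentagon" of level n) and T_n is the central face of
  omega(T_(n+1)); this is exactly the identification of K_n with the central superpentagon
  of K_(n+1).

  A superface is addressed by (n, p): start at T_n and descend along p, where p lists the
  descent steps bottom-up (last p = first step taken from T_n).  A step 0 means
  "central pentagon", a step s in {1..5} means "petal s" (petal v_s m_s c_s c_(s-1) m_(s-1)).
  Since T_n is the central child of T_(n+1), (Suc n, p @ [0]) and (n, p) address the same
  superface; canon strips such top-level central steps to get a canonical address.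

  Vertices: every vertex of K is created during some subdivision step, either as a centre
  vertex c_i of a superface G (named Cen G i) or as the midpoint of a superedge with
  endpoints a, b (named Mid {#a, b#}).\<close>

datatype vert = Cen "nat \<times> nat list" nat | Mid "vert multiset"

definition canon :: "nat \<Rightarrow> nat list \<Rightarrow> nat \<times> nat list" where
  "canon n p = (let z = length (takeWhile (\<lambda>x. x = 0) (rev p))
                in (n - z, take (length p - z) p))"

fun corner :: "nat \<Rightarrow> nat list \<Rightarrow> nat \<Rightarrow> vert" where
  "corner n [] j = Cen (Suc n, []) ((j + 4) mod 5)"
| "corner n (s # q) j =
     (if s = 0 then Cen (canon n q) ((j + 4) mod 5)
      else (let d = (j + 5 - s mod 5) mod 5 in
            if d = 0 then corner n q s
            else if d = 1 then Mid {# corner n q s, corner n q (s + 1) #}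
            else if d = 2 then Cen (canon n q) (s mod 5)
            else if d = 3 then Cen (canon n q) ((s + 4) mod 5)
            else Mid {# corner n q (s + 4), corner n q s #}))"

text \<open>A face (2-cell) of K is given by its list of 5 boundary vertices in cyclic order,
  position r carrying the corner label (residue) r.  The faces of K are the level-0
  superfaces.\<close>
definition K_faces :: "vert list set" where
  "K_faces = {map (corner n p) [0..<5] | n p. length p = n \<and> set p \<subseteq> {0..5}}"

text \<open>A patch: a finite set of faces of K (together with their edges and vertices).\<close>
definition patch_verts :: "vert list set \<Rightarrow> vert set" where
  "patch_verts P = (\<Union>f\<in>P. set f)"

definition share_edge :: "vert list \<Rightarrow> vert list \<Rightarrow> bool" where
  "share_edge f g \<longleftrightarrow> f \<noteq> g \<and>
     (\<exists>r<5. \<exists>s<5. {f ! r, f ! ((r + 1) mod 5)} = {g ! s, g ! ((s + 1) mod 5)})"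

definition chain_connected :: "vert list set \<Rightarrow> bool" where
  "chain_connected P \<longleftrightarrow>
     (\<forall>f\<in>P. \<forall>g\<in>P. (\<lambda>x y. x \<in> P \<and> y \<in> P \<and> share_edge x y)\<^sup>*\<^sup>* f g)"

text \<open>Geometric realisation of a patch: each pentagonal face is coned off from a new centre
  point; realised inside the space of functions (vertices + faces) => real with the product
  topology (on finitely many coordinates this is the Euclidean topology).\<close>
definition delta :: "'a \<Rightarrow> 'a \<Rightarrow> real" where
  "delta x = (\<lambda>y. if y = x then 1 else 0)"

definition tri :: "'a \<Rightarrow> 'a \<Rightarrow> 'a \<Rightarrow> ('a \<Rightarrow> real) set" where
  "tri a b c = {(\<lambda>y. \<alpha> * delta a y + \<beta> * delta b y + \<gamma> * delta c y) | \<alpha> \<beta> \<gamma>.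
                 \<alpha> \<ge> 0 \<and> \<beta> \<ge> 0 \<and> \<gamma> \<ge> 0 \<and> \<alpha> + \<beta> + \<gamma> = 1}"

definition realization :: "vert list set \<Rightarrow> ((vert + vert list) \<Rightarrow> real) set" where
  "realization P = (\<Union>f\<in>P. \<Union>r<5. tri (Inr f) (Inl (f ! r)) (Inl (f ! ((r + 1) mod 5))))"

definition simply_connected_patch :: "vert list set \<Rightarrow> bool" where
  "simply_connected_patch P \<longleftrightarrow> simply_connected (realization P)"

text \<open>Automorphism of a patch: a bijection of its vertex set mapping faces onto faces
  with corner labels preserved (label = position in the vertex list).\<close>
definition patch_automorphism :: "vert list set \<Rightarrow> (vert \<Rightarrow> vert) \<Rightarrow> bool" where
  "patch_automorphism P \<phi> \<longleftrightarrow>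
     bij_betw \<phi> (patch_verts P) (patch_verts P) \<and> (map \<phi>) ` P = P"

end

theory Submission
  imports Defs "HOL-Complex_Analysis.Complex_Analysis"
begin

text \<open>A face of \<open>K\<close> is determined by a vertex together with the label of its corner there, and the
  two faces at an edge give it labels differing by \<open>\<plusminus>2\<close> modulo 5. Hence, on a chain-connected patch, an
  automorphism fixing a vertex is the identity, and no automorphism of a patch flips an edge: if
  \<open>\<phi>\<close> has order \<open>m\<close>, the cyclic group it generates acts freely on vertices, edges and faces.

  A simply connected patch is acyclic: \<open>H\<^sup>1(P; \<int>) = 0\<close> follows by winding numbers, and the coboundary
  from edges to faces is onto because every finite set of faces has an edge lying in only one
  of them. A free action of a cyclic group of order \<open>m\<close> on an acyclic complex forces \<open>m = 1\<close>: choose a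
  0-cochain \<open>s\<close> of norm 1, write \<open>\<delta>s = (\<phi> - 1)u\<close>, note that \<open>\<delta>u\<close> is invariant, hence \<open>\<delta>u = N \<delta>v\<close> for
  some \<open>v\<close>, and \<open>u - N v = \<delta>y\<close>. Then \<open>s - (\<phi> - 1)y\<close> is a constant \<open>k\<close>, and taking norms gives \<open>m k = 1\<close>.\<close>

section \<open>Vertices of the subdivided superpentagons\<close>

text \<open>The label arithmetic has an inductive source. Both halves of a subdivided edge keep the
  label of that edge in each tile along it, so the shift by 2 or 3 found at edges interior to a
  subdivided pentagon is inherited at all later levels. Since a midpoint is named by an unordered
  pair, this shift is also what excludes reversed matches when a vertex and a label are shown to
  determine the tile; the two facts therefore go through one induction. As K is a limit, finitely
  many faces are compared inside one T_n, where their addresses have equal length.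

  The closing chase is Tate cohomology made explicit. Acyclicity gives an exact sequence 0 -> Z ->
  C^0 -> C^1 -> C^2 -> 0, and freeness of the action makes the three cochain groups free over the
  group ring of the cyclic group of order m. Tate cohomology vanishes on them, hence on Z, where in
  degree 0 it is Z/m. Integer coefficients are essential: over the rationals m k = 1 has a solution
  for every m.\<close>

lemma canon_props:
  assumes "length q \<le> n"
  obtains z where "z \<le> length q" "canon n q = (n - z, take (length q - z) q)"
    "q = take (length q - z) q @ replicate z 0"
proof -
  define z where "z = length (takeWhile (\<lambda>x. x = 0) (rev q))"
  have z: "z \<le> length q" unfolding z_def by (metis length_rev length_takeWhile_le)
  have "takeWhile (\<lambda>x. x = 0) (rev q) = replicate z 0"
    unfolding z_def by (rule replicate_eqI) (auto dest: set_takeWhileD)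
  then have "take z (rev q) = replicate z 0"
    by (metis takeWhile_eq_take z_def)
  then have "rev (take z (rev q)) = replicate z 0" by simp
  then have "drop (length q - z) q = replicate z 0" by (simp add: rev_take)
  then have "q = take (length q - z) q @ replicate z 0" by (metis append_take_drop_id)
  moreover have "canon n q = (n - z, take (length q - z) q)"
    unfolding canon_def z_def Let_def ..
  ultimately show thesis using that z by blast
qed

text \<open>The level component \<open>n - z\<close> records how many zeros were stripped, so at
  equal length both lists lost the same number and can be restored.\<close>

lemma canon_inj:
  assumes "length q \<le> n" "length q' \<le> n" "canon n q = canon n q'" "length q = length q'"
  shows "q = q'"
proof -
  obtain z where z: "z \<le> length q" "canon n q = (n - z, take (length q - z) q)"
    "q = take (length q - z) q @ replicate z 0" using canon_props[OF assms(1)] .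
  obtain z' where z': "z' \<le> length q'" "canon n q' = (n - z', take (length q' - z') q')"
    "q' = take (length q' - z') q' @ replicate z' 0" using canon_props[OF assms(2)] .
  have "z = z'" using z(1,2) z'(1,2) assms by auto
  then show ?thesis using z z' assms(3) by (metis prod.inject)
qed

text \<open>The subdivision depth below \<open>T\<^sub>n\<close> at which a vertex is created.\<close>

primrec depth :: "nat \<Rightarrow> vert \<Rightarrow> nat" where
  "depth n (Cen a i) = length (snd a) + 1 + n - fst a"
| "depth n (Mid M) = Suc (Max (set_mset (image_mset (depth n) M)))"

text \<open>Each stripped zero shortens the list and lowers the level by one, so
  \<open>depth\<close> does not see the stripping; \<open>length q \<le> n\<close> keeps the
  subtraction from truncating.\<close>

lemma depth_canon: "length q \<le> n \<Longrightarrow> depth n (Cen (canon n q) i) = Suc (length q)"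
  by (rule canon_props[of q n]) auto

section \<open>Corners and edges of a subdivided pentagon, with labels modulo 5\<close>

lemma corner_cong:
  assumes "j mod 5 = k mod 5"
  shows "corner n q j = corner n q k"
proof (cases q)
  case Nil
  have "(j + 4) mod 5 = (k + 4) mod 5" using assms by (metis mod_add_left_eq)
  then show ?thesis using Nil by simp
next
  case (Cons s q')
  have "(j + 4) mod 5 = (k + 4) mod 5" using assms by (metis mod_add_left_eq)
  moreover have "(j + 5 - s mod 5) mod 5 = (k + 5 - s mod 5) mod 5"
  proof -
    have "x + 5 - s mod 5 = x + (5 - s mod 5)" for x :: nat
      using mod_less_divisor[of 5 s] by linarith
    then show ?thesis using assms by (metis mod_add_left_eq)
  qed
  ultimately show ?thesis using Cons by simp
qed

lemma step_cases:
  assumes "s \<in> {0..5::nat}"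
  obtains "s = 0" | "s = 1" | "s = 2" | "s = 3" | "s = 4" | "s = 5"
  using assms by (auto simp: le_Suc_eq numeral_eq_Suc)

lemma corner_petal:
  assumes "s \<in> {0..5}" "s \<noteq> 0"
  shows "corner n (s # q) s = corner n q s"
    "corner n (s # q) (s + 1) = Mid {# corner n q s, corner n q (s + 1) #}"
    "corner n (s # q) (s + 2) = Cen (canon n q) (s mod 5)"
    "corner n (s # q) (s + 3) = Cen (canon n q) ((s + 4) mod 5)"
    "corner n (s # q) (s + 4) = Mid {# corner n q (s + 4), corner n q s #}"
    "corner n (s # q) (s + 5) = corner n q s"
  by (rule step_cases[OF assms(1)]; use assms(2) in simp)+

text \<open>The offset \<open>d\<close> is the position of a corner of petal s, counted from its
  tip, in the list v_s, m_s, c_s, c_(s-1), m_(s-1).\<close>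

lemma petal_offset:
  obtains d where "d < 5" "r mod 5 = (s + d) mod (5::nat)"
proof
  show "(r + 5 - s mod 5) mod 5 < 5" by simp
  have "s mod 5 \<le> r + 5" using mod_less_divisor[of 5 s] by linarith
  then have "s + (r + 5 - s mod 5) = r + 5 * (1 + s div 5)"
    using mult_div_mod_eq[of 5 s] unfolding distrib_left mult_1_right by linarith
  then show "r mod 5 = (s + (r + 5 - s mod 5) mod 5) mod 5"
    by (metis mod_add_right_eq mod_mult_self2)
qed

lemma offset_cases:
  assumes "(d::nat) < 5"
  obtains "d = 0" | "d = 1" | "d = 2" | "d = 3" | "d = 4"
  using assms by linarith

lemma mod5_cases:
  obtains "r mod 5 = (0::nat)" | "r mod 5 = 1" | "r mod 5 = 2" | "r mod 5 = 3" | "r mod 5 = 4"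
  using offset_cases[of "r mod 5"] mod_less_divisor[of 5 r] by (metis zero_less_numeral)

text \<open>Shifted residues become case distinctions on \<open>y mod 5\<close>, which turns the
  label congruences below into finite checks.\<close>

lemma shift5:
  "Suc y mod 5 = (if y mod 5 = 4 then 0 else Suc (y mod 5))"
  "(y + 2) mod 5 = (if y mod 5 < 3 then y mod 5 + 2 else y mod 5 - 3)"
  "(y + 3) mod 5 = (if y mod 5 < 2 then y mod 5 + 3 else y mod 5 - 2)"
  "(y + 4) mod 5 = (if y mod 5 < 1 then 4 else y mod 5 - 1)"
  "(y + 5) mod (5::nat) = y mod 5"
      apply (rule mod5_cases[of y]; simp add: mod_Suc)
     apply (rule mod5_cases[of y]; simp add: mod_Suc)
    apply (rule mod5_cases[of y]; simp add: mod_add_left_eq[of y 5, symmetric])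
   apply (rule mod5_cases[of y]; simp add: mod_add_left_eq[of y 5, symmetric])
  apply simp
  done
lemma add1_mod5: "(y + 1) mod 5 = (if y mod 5 = 4 then 0 else y mod 5 + (1::nat))"
  using shift5(1)[of y] by simp

lemma corner_cases [consumes 1, case_names central old mid cen cen' mid']:
  assumes "s \<in> {0..5}"
  obtains "s = 0" "corner n (s # q) r = Cen (canon n q) ((r + 4) mod 5)"
  | "s \<noteq> 0" "r mod 5 = s mod 5" "corner n (s # q) r = corner n q s"
  | "s \<noteq> 0" "r mod 5 = (s + 1) mod 5"
      "corner n (s # q) r = Mid {# corner n q s, corner n q (s + 1) #}"
  | "s \<noteq> 0" "r mod 5 = (s + 2) mod 5" "corner n (s # q) r = Cen (canon n q) (s mod 5)"
  | "s \<noteq> 0" "r mod 5 = (s + 3) mod 5" "corner n (s # q) r = Cen (canon n q) ((s + 4) mod 5)"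
  | "s \<noteq> 0" "r mod 5 = (s + 4) mod 5"
      "corner n (s # q) r = Mid {# corner n q (s + 4), corner n q s #}"
proof (cases "s = 0")
  case True
  then show ?thesis using that(1) by simp
next
  case False
  obtain d where d: "d < 5" "r mod 5 = (s + d) mod 5" by (rule petal_offset)
  have "corner n (s # q) r = corner n (s # q) (s + d)" by (rule corner_cong[OF d(2)])
  then show ?thesis
    using that(2-) False d(2) corner_petal[OF assms False, of n q]
    by (cases rule: offset_cases[OF d(1)]) (simp_all del: corner.simps)
qed

lemma edge_cases [consumes 1, case_names central old_mid mid_cen cen_cen cen_mid mid_old]:
  assumes "s \<in> {0..5}"
  obtains "s = 0" "corner n (s # q) r = Cen (canon n q) ((r + 4) mod 5)"
      "corner n (s # q) (r + 1) = Cen (canon n q) (r mod 5)"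
  | "s \<noteq> 0" "r mod 5 = s mod 5" "corner n (s # q) r = corner n q s"
      "corner n (s # q) (r + 1) = Mid {# corner n q s, corner n q (s + 1) #}"
  | "s \<noteq> 0" "r mod 5 = (s + 1) mod 5"
      "corner n (s # q) r = Mid {# corner n q s, corner n q (s + 1) #}"
      "corner n (s # q) (r + 1) = Cen (canon n q) (s mod 5)"
  | "s \<noteq> 0" "r mod 5 = (s + 2) mod 5"
      "corner n (s # q) r = Cen (canon n q) (s mod 5)"
      "corner n (s # q) (r + 1) = Cen (canon n q) ((s + 4) mod 5)"
  | "s \<noteq> 0" "r mod 5 = (s + 3) mod 5"
      "corner n (s # q) r = Cen (canon n q) ((s + 4) mod 5)"
      "corner n (s # q) (r + 1) = Mid {# corner n q (s + 4), corner n q s #}"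
  | "s \<noteq> 0" "r mod 5 = (s + 4) mod 5"
      "corner n (s # q) r = Mid {# corner n q (s + 4), corner n q s #}"
      "corner n (s # q) (r + 1) = corner n q s"
proof (cases "s = 0")
  case True
  then show ?thesis using that(1) by simp
next
  case False
  obtain d where d: "d < 5" "r mod 5 = (s + d) mod 5" by (rule petal_offset)
  have c: "corner n (s # q) r = corner n (s # q) (s + d)" by (rule corner_cong[OF d(2)])
  have c1: "corner n (s # q) (r + 1) = corner n (s # q) (s + Suc d)"
    by (rule corner_cong) (metis add_Suc_right add.commute d(2) mod_add_left_eq plus_1_eq_Suc)
  note cp = corner_petal[OF assms False, of n q]
  show ?thesis
  proof (cases rule: offset_cases[OF d(1)])
    case 1
    have "corner n (s # q) r = corner n q s" using c unfolding 1 add_0_right cp .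
    moreover have "corner n (s # q) (r + 1) = Mid {# corner n q s, corner n q (s + 1) #}"
      using c1 cp(2) unfolding 1 One_nat_def by (rule trans)
    ultimately show ?thesis using that(2) False d(2) 1 by simp
  next
    case 2
    have n2: "Suc 1 = 2" by simp
    show ?thesis
      by (rule that(3)[OF False _ _ _]) (use d(2) c c1 in \<open>unfold 2 n2 cp\<close>)
  next
    case 3
    have n3: "Suc 2 = 3" by simp
    show ?thesis
      by (rule that(4)[OF False _ _ _]) (use d(2) c c1 in \<open>unfold 3 n3 cp\<close>)
  next
    case 4
    have n4: "Suc 3 = 4" by simp
    show ?thesis
      by (rule that(5)[OF False _ _ _]) (use d(2) c c1 in \<open>unfold 4 n4 cp\<close>)
  next
    case 5
    have n5: "Suc 4 = 5" by simp
    show ?thesis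
      by (rule that(6)[OF False _ _ _]) (use d(2) c c1 in \<open>unfold 5 n5 cp\<close>)
  qed
qed

lemma Mid_eq_iff: "Mid {#a, b#} = Mid {#c, d#} \<longleftrightarrow> (a = c \<and> b = d) \<or> (a = d \<and> b = c)"
  by (auto simp: add_eq_conv_ex)

section \<open>Identification of tiles by their vertices and edges\<close>

definition addr :: "nat \<Rightarrow> nat \<Rightarrow> nat list \<Rightarrow> bool" where
  "addr n l q \<longleftrightarrow> length q = l \<and> l \<le> n \<and> set q \<subseteq> {0..5}"

lemma addr_0: "addr n 0 q \<longleftrightarrow> q = []"
  by (auto simp: addr_def)

lemma addr_SucE:
  assumes "addr n (Suc l) q"
  obtains s p where "q = s # p" "s \<in> {0..5}" "addr n l p" "length p \<le> n" "length p = l"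
  using assms unfolding addr_def by (cases q) auto

text \<open>An edge of a subtile is interior to the parent or half of one of its edges, so at least
  one end is new. This is what makes the midpoint of any edge strictly deeper than all vertices
  before it.\<close>

lemma depth_corner:
  assumes "addr n l q"
  shows "depth n (corner n q r) \<le> l \<and> (depth n (corner n q r) = l \<or>
      depth n (corner n q (r + 1)) = l)"
  using assms
proof (induction l arbitrary: q r)
  case 0
  then show ?case by (simp add: addr_0)
next
  case (Suc l)
  obtain s p where p: "q = s # p" "s \<in> {0..5}" "addr n l p" "length p \<le> n" "length p = l"
    using addr_SucE[OF Suc.prems] .
  have c: "depth n (Cen (canon n p) i) = Suc l" for i using depth_canon p by blast
  have le: "depth n (corner n p i) \<le> l" for i using Suc.IH[OF p(3)] by blast
  have m: "depth n (Mid {# corner n p i, corner n p (i + 1) #}) = Suc l" for i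
    using Suc.IH[OF p(3), of i] le[of i] le[of "i+1"] by (auto simp del: corner.simps)
  have s5: "corner n p s = corner n p (s + 4 + 1)" by (rule corner_cong) simp
  have m4: "depth n (Mid {# corner n p (s + 4), corner n p s #}) = Suc l"
    using m[of "s + 4"] s5 by simp
  show ?case using p(2)
  proof (cases rule: edge_cases[where n = n and q = p and r = r])
    case central then show ?thesis unfolding p(1) central(2,3) c by simp
  next
    case old_mid then show ?thesis unfolding p(1) old_mid(3,4) m using le[of s] by linarith
  next
    case mid_cen then show ?thesis unfolding p(1) mid_cen(3,4) m c by simp
  next
    case cen_cen then show ?thesis unfolding p(1) cen_cen(3,4) c by simp
  next
    case cen_mid then show ?thesis unfolding p(1) cen_mid(3,4) c by simp
  next
    case mid_old then show ?thesis unfolding p(1) mid_old(3,4) m4 by simp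
  qed
qed

lemma depth_Mid:
  assumes "addr n l p"
  shows "depth n (Mid {# corner n p j, corner n p (j + 1) #}) = Suc l"
  using depth_corner[OF assms, of j] depth_corner[OF assms, of "j + 1"] by auto

text \<open>The clauses are bundled because the step from one level to the next mixes them: equal
  midpoints match their edges either in the same direction, where the third clause identifies the
  tiles, or reversed, where the fourth restricts the labels. There \<open>r\<close> and
  \<open>s\<close> are the labels of one edge seen from its two sides.\<close>

definition addressing :: "nat \<Rightarrow> nat \<Rightarrow> bool" where
  "addressing n l \<longleftrightarrow> (\<forall>q q' r s. addr n l q \<longrightarrow> addr n l q' \<longrightarrow>
     (corner n q r = corner n q s \<longrightarrow> r mod 5 = s mod 5) \<and>
     (corner n q r = corner n q' r \<longrightarrow> q = q') \<and>
     (corner n q r = corner n q' s \<and> corner n q (r + 1) = corner n q' (s + 1) \<longrightarrow> q = q') \<and>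
     (corner n q r = corner n q' (s + 1) \<and> corner n q (r + 1) = corner n q' s \<longrightarrow>
        s mod 5 = (r + 2) mod 5 \<or> s mod 5 = (r + 3) mod 5))"

lemma addressing_0: "addressing n 0"
proof -
  have 1: "r mod 5 = s mod 5" if "(r + 4) mod 5 = (s + 4) mod (5::nat)" for r s
    using that by (cases r rule: mod5_cases; cases s rule: mod5_cases; auto simp: shift5)
  \<comment> \<open>A pentagon never traverses one of its own edges backwards, so the fourth clause
    is vacuous for T_n alone.\<close>
  have 2: False if "(r + 4) mod 5 = (s + 1 + 4) mod (5::nat)"
      "(r + 1 + 4) mod 5 = (s + 4) mod (5::nat)" for r s
    using that by (cases r rule: mod5_cases; cases s rule: mod5_cases; auto simp: shift5)
  have c: "corner n [] r = corner n [] s \<longleftrightarrow> (r + 4) mod 5 = (s + 4) mod 5" for r s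
    by simp
  show ?thesis unfolding addressing_def addr_0
    by (intro allI impI conjI; hypsubst) (unfold c, (metis 1 2)+)
qed

text \<open>Centres and midpoints created in this subdivision have depth \<open>Suc l\<close>,
  beyond every corner of a parent tile, so only the tip of a petal remains.\<close>

lemma corner_eq_old:
  assumes "addr n l p" "addr n l p'" "s \<in> {0..5}" "corner n (s # p) r = corner n p' i"
  shows "s \<noteq> 0 \<and> r mod 5 = s mod 5 \<and> corner n p s = corner n p' i"
proof -
  have le: "depth n (corner n p' i) \<le> l" using depth_corner[OF assms(2)] by blast
  have p: "length p \<le> n" "length p = l" using assms(1) unfolding addr_def by auto
  have c: "Cen (canon n p) j \<noteq> corner n p' i" for j
    using depth_canon[OF p(1), of j] p(2) le by (metis Suc_n_not_le_n)
  have m: "Mid {# corner n p j, corner n p (j + 1) #} \<noteq> corner n p' i" for j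
    using depth_Mid[OF assms(1)] le by (metis Suc_n_not_le_n)
  have s5: "corner n p s = corner n p (s + 4 + 1)" by (rule corner_cong) simp
  have m4: "Mid {# corner n p (s + 4), corner n p s #} \<noteq> corner n p' i" 
    using m[of "s + 4"] unfolding s5[symmetric] .
  show ?thesis using assms(3)
  proof (cases rule: corner_cases[where n = n and q = p and r = r])
    case central then show ?thesis using c assms(4) by metis
  next
    case old then show ?thesis using assms(4) by metis
  next
    case mid then show ?thesis using m assms(4) by metis
  next
    case cen then show ?thesis using c assms(4) by metis
  next
    case cen' then show ?thesis using c assms(4) by metis
  next
    case mid' then show ?thesis using m4 assms(4) by metis
  qed
qed

text \<open>\<open>centre_at s r i\<close>: the corner of label \<open>r\<close> in the subtile \<open>s\<close> is the centre vertex \<open>c\<^sub>i\<close>.\<close>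

definition centre_at :: "nat \<Rightarrow> nat \<Rightarrow> nat \<Rightarrow> bool" where
  "centre_at s r i \<longleftrightarrow> s = 0 \<and> (r + 4) mod 5 = i mod 5 \<or>
     s \<noteq> 0 \<and> r mod 5 = (s + 2) mod 5 \<and> i mod 5 = s mod 5 \<or>
     s \<noteq> 0 \<and> r mod 5 = (s + 3) mod 5 \<and> i mod 5 = (s + 4) mod 5"

lemma corner_eq_Cen:
  assumes "addr n l p" "addr n l p'" "s \<in> {0..5}" "corner n (s # p) r = Cen (canon n p') (i mod 5)"
  shows "p = p' \<and> centre_at s r i"
proof -
  have p: "length p' \<le> n" "length p' = l" "length p \<le> n" "length p = l"
    using assms(1,2) unfolding addr_def by auto
  have o: "corner n p j \<noteq> Cen (canon n p') (i mod 5)" for j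
    using depth_corner[OF assms(1), of j] depth_canon[OF p(1), of "i mod 5"] p(2)
      by (metis Suc_n_not_le_n)
  have e: "Cen (canon n p) j = Cen (canon n p') (i mod 5) \<Longrightarrow> p = p' \<and> j = i mod 5" for j
    using canon_inj[of p n p'] p by auto
  show ?thesis using assms(3)
  proof (cases rule: corner_cases[where n = n and q = p and r = r])
    case central then show ?thesis using e assms(4) unfolding centre_at_def by metis
  next
    case old then show ?thesis using assms(4) o by metis
  next
    case mid then show ?thesis using assms(4) by simp
  next
    case cen then show ?thesis using e assms(4) unfolding centre_at_def by metis
  next
    case cen' then show ?thesis using e assms(4) unfolding centre_at_def by metis
  next
    case mid' then show ?thesis using assms(4) by simp
  qed
qed

text \<open>\<open>j\<close> is the edge of the parent whose midpoint is met: petal s contains m_s,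
  on edge s, and m_(s-1), on edge s + 4. The final disjunction lists the two ways to match unordered
  pairs.\<close>

lemma corner_eq_Mid:
  assumes "addressing n l" "addr n l p" "addr n l p'" "s \<in> {0..5}"
    "corner n (s # p) r = Mid {# corner n p' i, corner n p' (i + 1) #}"
  obtains j where "s \<noteq> 0" "r mod 5 = (s + 1) mod 5 \<and> j = s \<or> r mod 5 = (s + 4) mod 5 \<and> j = s + 4"
    "p = p' \<and> j mod 5 = i mod 5 \<or> corner n p j = corner n p' (i + 1) \<and>
        corner n p (j + 1) = corner n p' i"
proof -
  have p: "length p' \<le> n" "length p' = l" "length p \<le> n" "length p = l"
    using assms(2,3) unfolding addr_def by auto
  have o: "corner n p j \<noteq> Mid {# corner n p' i, corner n p' (i + 1) #}" for j
    using depth_corner[OF assms(2), of j] depth_Mid[OF assms(3)] by (metis Suc_n_not_le_n)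
  have s5: "corner n p s = corner n p (s + 4 + 1)" by (rule corner_cong) simp
  have e: "p = p' \<and> j mod 5 = i mod 5 \<or> corner n p j = corner n p' (i + 1) \<and>
      corner n p (j + 1) = corner n p' i"
    if "Mid {# corner n p j, corner n p (j + 1) #} = Mid {# corner n p' i, corner n p' (i + 1) #}"
        for j
    using that assms(1-3) unfolding Mid_eq_iff addressing_def by metis
  show ?thesis using assms(4)
  proof (cases rule: corner_cases[where n = n and q = p and r = r])
    case central then show ?thesis using assms(5) by simp
  next
    case old then show ?thesis using assms(5) o by metis
  next
    case mid then show ?thesis using that[of s] assms(5) e by metis
  next
    case cen then show ?thesis using assms(5) by simp
  next
    case cen' then show ?thesis using assms(5) by simp
  next
    case mid' then show ?thesis using that[of "s + 4"] assms(5) e s5 by metis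
  qed
qed

lemma neq_shift: "r mod 5 \<noteq> (r + 1) mod 5" "r mod 5 \<noteq> (r + 4) mod (5::nat)"
  by (cases r rule: mod5_cases; auto simp: shift5)+

lemma shift_trans: "r mod 5 = (s + c) mod 5 \<Longrightarrow> (r + d) mod 5 = (s + (c + d)) mod (5::nat)"
  by (metis add.assoc mod_add_left_eq)

lemma shift_neq: "r mod 5 \<noteq> (r + 2) mod 5" "r mod 5 \<noteq> (r + 3) mod (5::nat)"
  "(r + 1) mod 5 \<noteq> (r + 4) mod 5" "(r + 1) mod 5 \<noteq> (r + 2) mod 5" "(r + 1) mod 5 \<noteq> (r + 3) mod 5"
  by (cases r rule: mod5_cases; auto simp: shift5)+

text \<open>Two subtiles traversing a common edge in opposite directions either lie along a common
  edge of their parents (first alternative) or are siblings.\<close>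

lemma reversed_edge_cases:
  assumes l: "addressing n l" and p: "addr n l p" and s: "s \<in> {0..5}" and p': "addr n l p'"
    and t: "t \<in> {0..5}" and e1: "corner n (s # p) r = corner n (t # p') (k + 1)"
    and e2: "corner n (s # p) (r + 1) = corner n (t # p') k"
  shows "(s \<noteq> 0 \<and> t \<noteq> 0 \<and> (\<exists>a b. r mod 5 = a mod 5 \<and> k mod 5 = b mod 5 \<and> (a = s \<and> b = t + 4 \<or>
      a = s + 4 \<and> b = t) \<and>
      corner n p a = corner n p' (b + 1) \<and> corner n p (a + 1) = corner n p' b)) \<or>
    (p' = p \<and> (s = 0 \<and> t \<noteq> 0 \<and> k mod 5 = (r + 2) mod 5 \<or>
      s \<noteq> 0 \<and> t = 0 \<and> r mod 5 = (s + 2) mod 5 \<and> k mod 5 = s mod 5 \<or>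
      s \<noteq> 0 \<and> t \<noteq> 0 \<and> r mod 5 = (s + 1) mod 5 \<and> k mod 5 = (s + 4) mod 5 \<and> t mod 5 = (s + 1) mod 5 \<or>
      s \<noteq> 0 \<and> t \<noteq> 0 \<and> r mod 5 = (s + 3) mod 5 \<and> k mod 5 = s mod 5 \<and> t mod 5 = (s + 4) mod 5))"
    (is "?outer \<or> ?inner")
  using s
proof (cases rule: edge_cases[where n = n and q = p and r = r])
  case central
  have "p' = p \<and> centre_at t (k + 1) (r + 4)"
    using corner_eq_Cen[OF p' p t] central e1 by metis
  moreover have "p' = p \<and> centre_at t k r"
    using corner_eq_Cen[OF p' p t] central e2 by metis
  moreover have "t \<noteq> 0 \<and> k mod 5 = (r + 2) mod 5" if "centre_at t (k + 1) (r + 4)"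
      "centre_at t k r"
  proof -
    obtain a b c where a: "r mod 5 = a" "k mod 5 = b" "t mod 5 = c" "a < 5" "b < 5" "c < 5"
      by simp
    show ?thesis using that a(4-) unfolding centre_at_def shift5 add1_mod5 a(1-3)
      by (elim offset_cases; hypsubst; simp)
  qed
  ultimately show ?thesis using central(1) by metis
next
  case old_mid
  have k: "t \<noteq> 0 \<and> (k + 1) mod 5 = t mod 5 \<and> corner n p' t = corner n p s"
    using corner_eq_old[OF p' p t] old_mid e1 by metis
  have "corner n (t # p') k = Mid {#corner n p s, corner n p (s + 1)#}" using old_mid e2 by simp
  then obtain j where j: "t \<noteq> 0" "k mod 5 = (t + 1) mod 5 \<and> j = t \<or> k mod 5 = (t + 4) mod 5 \<and>
      j = t + 4"
      "p' = p \<and> j mod 5 = s mod 5 \<or> corner n p' j = corner n p (s + 1) \<and>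
          corner n p' (j + 1) = corner n p s"
      by (rule corner_eq_Mid[OF l p' p t])
  have jt: "j = t + 4" "k mod 5 = (t + 4) mod 5" using j(2) k
    by (cases k rule: mod5_cases; cases t rule: mod5_cases; auto simp: shift5)+
  moreover have "\<not> (p' = p \<and> (t + 4) mod 5 = s mod 5)"
    using l p k unfolding addressing_def by (metis neq_shift(2))
  ultimately have ?outer using k j(3) old_mid(1,2) by metis
  then show ?thesis ..
next
  case mid_cen
  have "corner n (t # p') (k + 1) = Mid {#corner n p s, corner n p (s + 1)#}" using mid_cen e1
    by simp
  then obtain j where j: "t \<noteq> 0" "(k + 1) mod 5 = (t + 1) mod 5 \<and> j = t \<or>
      (k + 1) mod 5 = (t + 4) mod 5 \<and> j = t + 4"
      "p' = p \<and> j mod 5 = s mod 5 \<or> corner n p' j = corner n p (s + 1) \<and>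
          corner n p' (j + 1) = corner n p s"
      by (rule corner_eq_Mid[OF l p' p t])
  have "p' = p \<and> centre_at t k s"
    using corner_eq_Cen[OF p' p t] mid_cen e2 by metis
  moreover have "k mod 5 = (s + 4) mod 5 \<and> t mod 5 = (s + 1) mod 5" if "centre_at t k s"
  proof -
    obtain a b c where a: "k mod 5 = a" "t mod 5 = b" "s mod 5 = c" "a < 5" "b < 5" "c < 5"
      by simp
    show ?thesis using that j(1,2) a(4-) unfolding centre_at_def shift5 add1_mod5 a(1-3)
      by (elim offset_cases; hypsubst; simp)
  qed
  ultimately show ?thesis using mid_cen(1,2) j(1) by simp
next
  case cen_cen
  have "p' = p \<and> centre_at t (k + 1) s"
    using corner_eq_Cen[OF p' p t] cen_cen e1 by metis
  moreover have "p' = p \<and> centre_at t k (s + 4)"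
    using corner_eq_Cen[OF p' p t] cen_cen e2 by metis
  moreover have "t = 0 \<and> k mod 5 = s mod 5" if "centre_at t (k + 1) s"
      "centre_at t k (s + 4)"
  proof -
    obtain a b c where a: "s mod 5 = a" "k mod 5 = b" "t mod 5 = c" "a < 5" "b < 5" "c < 5"
      by simp
    show ?thesis using that a(4-) unfolding centre_at_def shift5 add1_mod5 a(1-3)
      by (elim offset_cases; hypsubst; simp)
  qed
  ultimately show ?thesis using cen_cen(1,2) by metis
next
  case cen_mid
  have "corner n p s = corner n p (s + 4 + 1)" by (rule corner_cong) simp
  then have "corner n (t # p') k = Mid {#corner n p (s + 4), corner n p (s + 4 + 1)#}"
    using cen_mid e2 by metis
  then obtain j where j: "t \<noteq> 0" "k mod 5 = (t + 1) mod 5 \<and> j = t \<or> k mod 5 = (t + 4) mod 5 \<and>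
      j = t + 4"
      "p' = p \<and> j mod 5 = (s + 4) mod 5 \<or> corner n p' j = corner n p (s + 4 + 1) \<and>
          corner n p' (j + 1) = corner n p (s + 4)"
      by (rule corner_eq_Mid[OF l p' p t])
  have "p' = p \<and> centre_at t (k + 1) (s + 4)"
    using corner_eq_Cen[OF p' p t] cen_mid e1 by metis
  moreover have "k mod 5 = s mod 5 \<and> t mod 5 = (s + 4) mod 5" if "centre_at t (k + 1) (s + 4)"
  proof -
    obtain a b c where a: "s mod 5 = a" "t mod 5 = b" "k mod 5 = c" "a < 5" "b < 5" "c < 5"
      by simp
    show ?thesis using that j(1,2) a(4-) unfolding centre_at_def shift5 add1_mod5 a(1-3)
      by (elim offset_cases; hypsubst; simp)
  qed
  ultimately show ?thesis using cen_mid(1,2) j(1) by simp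
next
  case mid_old
  have k: "t \<noteq> 0 \<and> k mod 5 = t mod 5 \<and> corner n p' t = corner n p s"
    using corner_eq_old[OF p' p t] mid_old e2 by metis
  have "corner n p s = corner n p (s + 4 + 1)" by (rule corner_cong) simp
  then have "corner n (t # p') (k + 1) = Mid {#corner n p (s + 4), corner n p (s + 4 + 1)#}"
    using mid_old e1 by metis
  then obtain j where j: "t \<noteq> 0" "(k + 1) mod 5 = (t + 1) mod 5 \<and> j = t \<or>
      (k + 1) mod 5 = (t + 4) mod 5 \<and> j = t + 4"
      "p' = p \<and> j mod 5 = (s + 4) mod 5 \<or> corner n p' j = corner n p (s + 4 + 1) \<and>
          corner n p' (j + 1) = corner n p (s + 4)"
      by (rule corner_eq_Mid[OF l p' p t])
  have jt: "j = t" using j(2) k by (cases k rule: mod5_cases; cases t rule: mod5_cases; auto simp: shift5)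
  moreover have "\<not> (p' = p \<and> t mod 5 = (s + 4) mod 5)"
    using l p k unfolding addressing_def by (metis neq_shift(2))
  ultimately have ?outer using k j(3) mid_old(1,2) by metis
  then show ?thesis ..
qed

lemma addressing_Suc:
  assumes l: "addressing n l"
  shows "addressing n (Suc l)"
proof -
  have A1: "corner n (s # p) r = corner n (s # p) k \<Longrightarrow> r mod 5 = k mod 5"
    if p: "addr n l p" and s: "s \<in> {0..5}" for s p r k
    using s
  proof (cases rule: corner_cases[where n = n and q = p and r = r])
    case central
    assume "corner n (s # p) r = corner n (s # p) k"
    then have "(k + 4) mod 5 = (r + 4) mod 5"
      using corner_eq_Cen[OF p p s, unfolded centre_at_def] central by metis
    then show ?thesis by (cases k rule: mod5_cases; cases r rule: mod5_cases; auto simp: shift5)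
  next
    case old
    assume "corner n (s # p) r = corner n (s # p) k"
    then show ?thesis using corner_eq_old[OF p p s] old by metis
  next
    case mid
    assume "corner n (s # p) r = corner n (s # p) k"
    then have "corner n (s # p) k = Mid {#corner n p s, corner n p (s + 1)#}" using mid by simp
    then obtain j where 1: "s \<noteq> 0" "k mod 5 = (s + 1) mod 5 \<and> j = s \<or> k mod 5 = (s + 4) mod 5 \<and>
        j = s + 4"
      "p = p \<and> j mod 5 = s mod 5 \<or> corner n p j = corner n p (s + 1) \<and>
          corner n p (j + 1) = corner n p s"
      by (rule corner_eq_Mid[OF l p p s])
    from 1(3) have "j mod 5 = s mod 5 \<or> j mod 5 = (s + 1) mod 5 \<and> (j + 1) mod 5 = s mod 5"
      using l p unfolding addressing_def by metis
    then show ?thesis using 1(2) mid(2) by (cases k rule: mod5_cases; cases s rule: mod5_cases; auto simp: shift5)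
  next
    case cen
    assume "corner n (s # p) r = corner n (s # p) k"
    then have "k mod 5 = (s + 2) mod 5 \<or> k mod 5 = (s + 3) mod 5 \<and> s mod 5 = (s + 4) mod 5"
      using corner_eq_Cen[OF p p s, unfolded centre_at_def] cen by metis
    then show ?thesis using cen(2) by (cases k rule: mod5_cases; cases s rule: mod5_cases; auto simp: shift5)
  next
    case cen'
    assume "corner n (s # p) r = corner n (s # p) k"
    then have "k mod 5 = (s + 3) mod 5 \<or> k mod 5 = (s + 2) mod 5 \<and> (s + 4) mod 5 = s mod 5"
      using corner_eq_Cen[OF p p s, unfolded centre_at_def] cen' by metis
    then show ?thesis using cen'(2) by (cases k rule: mod5_cases; cases s rule: mod5_cases; auto simp: shift5)
  next
    case mid'
    assume "corner n (s # p) r = corner n (s # p) k"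
    moreover have "corner n p s = corner n p (s + 4 + 1)" by (rule corner_cong) simp
    ultimately have "corner n (s # p) k = Mid {#corner n p (s + 4), corner n p (s + 4 + 1)#}"
      using mid' by metis
    then obtain j where 1: "s \<noteq> 0" "k mod 5 = (s + 1) mod 5 \<and> j = s \<or> k mod 5 = (s + 4) mod 5 \<and>
        j = s + 4"
      "p = p \<and> j mod 5 = (s + 4) mod 5 \<or> corner n p j = corner n p (s + 4 + 1) \<and>
          corner n p (j + 1) = corner n p (s + 4)"
      by (rule corner_eq_Mid[OF l p p s])
    from 1(3) have "j mod 5 = (s + 4) mod 5 \<or> j mod 5 = (s + 4 + 1) mod 5 \<and>
        (j + 1) mod 5 = (s + 4) mod 5"
      using l p unfolding addressing_def by metis
    then show ?thesis using 1(2) mid'(2)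
      by (cases k rule: mod5_cases; cases s rule: mod5_cases; auto simp: shift5)
  qed
  \<comment> \<open>The steps 0 and 5 coincide modulo 5; once the central step is excluded, the
    residue determines the petal.\<close>
  have step: "s = t" if "s mod 5 = t mod 5" "s \<noteq> 0" "t \<noteq> 0" "s \<in> {0..5}" "t \<in> {0..5}" for s t :: nat
    using that(4,5,1-3) by (elim step_cases) simp_all
  have A2: "s # p = t # p'" if eq: "corner n (s # p) r = corner n (t # p') r"
    and p: "addr n l p" and s: "s \<in> {0..5}" and p': "addr n l p'" and t: "t \<in> {0..5}" for s p r t p'
    using s
  proof (cases rule: corner_cases[where n = n and q = p and r = r])
    case central
    then have "p' = p \<and> (t = 0 \<or> r mod 5 = (t + 2) mod 5 \<and> (r + 4) mod 5 = t mod 5 \<or>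
      r mod 5 = (t + 3) mod 5 \<and> (r + 4) mod 5 = (t + 4) mod 5)"
      using corner_eq_Cen[OF p' p t, unfolded centre_at_def] eq by metis
    then have "p' = p \<and> t = 0" by (cases r rule: mod5_cases; cases t rule: mod5_cases; auto simp: shift5)
    then show ?thesis using central(1) by simp
  next
    case old
    then have *: "t \<noteq> 0 \<and> r mod 5 = t mod 5 \<and> corner n p' t = corner n p s"
      using corner_eq_old[OF p' p t] eq by metis
    moreover have "corner n p' t = corner n p' s" by (rule corner_cong) (metis old(2) *)
    ultimately have "p' = p" using l p p' unfolding addressing_def by metis
    then show ?thesis using step[of s t] old(1,2) s t * by metis
  next
    case mid
    then have "corner n (t # p') r = Mid {#corner n p s, corner n p (s + 1)#}" using eq by simp
    then obtain j where 1: "t \<noteq> 0" "r mod 5 = (t + 1) mod 5 \<and> j = t \<or> r mod 5 = (t + 4) mod 5 \<and>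
        j = t + 4"
      "p' = p \<and> j mod 5 = s mod 5 \<or> corner n p' j = corner n p (s + 1) \<and>
          corner n p' (j + 1) = corner n p s"
      by (rule corner_eq_Mid[OF l p' p t])
    \<comment> \<open>A reversed match would shift the edge label by 2 or 3, which is incompatible
      with the midpoint carrying the same label \<open>r\<close> in both petals.\<close>
    from 1(3) have "p' = p \<and> j mod 5 = s mod 5 \<or> s mod 5 = (j + 2) mod 5 \<or> s mod 5 = (j + 3) mod 5"
      using l p p' unfolding addressing_def by metis
    then have "p' = p \<and> s mod 5 = t mod 5" using 1(2) mid(2)
      by (cases t rule: mod5_cases; cases s rule: mod5_cases; auto simp: shift5)
    then show ?thesis using step[of s t] mid(1) s t 1(1) by simp
  next
    case cen
    then have "p' = p \<and> centre_at t r s"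
      using corner_eq_Cen[OF p' p t] eq by metis
    then have "p' = p \<and> t \<noteq> 0 \<and> s mod 5 = t mod 5" using cen(2) unfolding centre_at_def
      by (cases t rule: mod5_cases; cases s rule: mod5_cases; auto simp: shift5)
    then show ?thesis using step[of s t] cen(1) s t by simp
  next
    case cen'
    then have "p' = p \<and> centre_at t r (s + 4)"
      using corner_eq_Cen[OF p' p t] eq by metis
    then have "p' = p \<and> t \<noteq> 0 \<and> s mod 5 = t mod 5" using cen'(2) unfolding centre_at_def
      by (cases t rule: mod5_cases; cases s rule: mod5_cases; auto simp: shift5)
    then show ?thesis using step[of s t] cen'(1) s t by simp
  next
    case mid'
    have "corner n p s = corner n p (s + 4 + 1)" by (rule corner_cong) simp
    then have "corner n (t # p') r = Mid {#corner n p (s + 4), corner n p (s + 4 + 1)#}"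
      using mid' eq by metis
    then obtain j where 1: "t \<noteq> 0" "r mod 5 = (t + 1) mod 5 \<and> j = t \<or> r mod 5 = (t + 4) mod 5 \<and>
        j = t + 4"
      "p' = p \<and> j mod 5 = (s + 4) mod 5 \<or> corner n p' j = corner n p (s + 4 + 1) \<and>
          corner n p' (j + 1) = corner n p (s + 4)"
      by (rule corner_eq_Mid[OF l p' p t])
    from 1(3) have "p' = p \<and> j mod 5 = (s + 4) mod 5 \<or> (s + 4) mod 5 = (j + 2) mod 5 \<or>
        (s + 4) mod 5 = (j + 3) mod 5"
      using l p p' unfolding addressing_def by metis
    then have "p' = p \<and> s mod 5 = t mod 5" using 1(2) mid'(2)
      by (cases t rule: mod5_cases; cases s rule: mod5_cases; auto simp: shift5)
    then show ?thesis using step[of s t] mid'(1) s t 1(1) by simp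
  qed
  have A3: "s # p = t # p'"
    if e1: "corner n (s # p) r = corner n (t # p') k"
        and e2: "corner n (s # p) (r + 1) = corner n (t # p') (k + 1)"
      and p: "addr n l p" and s: "s \<in> {0..5}" and p': "addr n l p'"
          and t: "t \<in> {0..5}" for s p r t p' k
    using s
  proof (cases rule: edge_cases[where n = n and q = p and r = r])
    case central
    have "p' = p \<and> centre_at t k (r + 4)"
      using corner_eq_Cen[OF p' p t] central e1 by metis
    moreover have "p' = p \<and> centre_at t (k + 1) r"
      using corner_eq_Cen[OF p' p t] central e2 by metis
    moreover have "t = 0" if "centre_at t k (r + 4)"
      "centre_at t (k + 1) r"
    proof -
      obtain a b c where a: "r mod 5 = a" "k mod 5 = b" "t mod 5 = c" "a < 5" "b < 5" "c < 5"
        by simp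
      show ?thesis using that a(4-) unfolding centre_at_def shift5 add1_mod5 a(1-3)
        by (elim offset_cases; hypsubst; simp)
    qed
    ultimately show ?thesis using central(1) by metis
  next
    case old_mid
    have k: "t \<noteq> 0 \<and> k mod 5 = t mod 5 \<and> corner n p' t = corner n p s"
      using corner_eq_old[OF p' p t] old_mid e1 by metis
    have "corner n (t # p') (k + 1) = Mid {#corner n p s, corner n p (s + 1)#}" using old_mid e2
      by simp
    then obtain j where j: "t \<noteq> 0" "(k + 1) mod 5 = (t + 1) mod 5 \<and> j = t \<or>
        (k + 1) mod 5 = (t + 4) mod 5 \<and> j = t + 4"
      "p' = p \<and> j mod 5 = s mod 5 \<or> corner n p' j = corner n p (s + 1) \<and>
          corner n p' (j + 1) = corner n p s"
      by (rule corner_eq_Mid[OF l p' p t])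
    have "j = t" using j(2) k by (cases k rule: mod5_cases; cases t rule: mod5_cases; auto simp: shift5)
    moreover have "corner n p s \<noteq> corner n p (s + 1)"
      using l p unfolding addressing_def by (metis neq_shift)
    ultimately have "p' = p \<and> t mod 5 = s mod 5" using j(3) k by metis
    then show ?thesis using step[of s t] old_mid(1) s t j(1) by simp
  next
    case mid_cen
    have "corner n (t # p') k = Mid {#corner n p s, corner n p (s + 1)#}" using mid_cen e1 by simp
    then obtain j where j: "t \<noteq> 0" "k mod 5 = (t + 1) mod 5 \<and> j = t \<or> k mod 5 = (t + 4) mod 5 \<and>
        j = t + 4"
      "p' = p \<and> j mod 5 = s mod 5 \<or> corner n p' j = corner n p (s + 1) \<and>
          corner n p' (j + 1) = corner n p s"
      by (rule corner_eq_Mid[OF l p' p t])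
    have "p' = p \<and> centre_at t (k + 1) s"
      using corner_eq_Cen[OF p' p t] mid_cen e2 by metis
    moreover have "s mod 5 = t mod 5" if "centre_at t (k + 1) s"
    proof -
      obtain a b c where a: "k mod 5 = a" "t mod 5 = b" "s mod 5 = c" "a < 5" "b < 5" "c < 5"
        by simp
      show ?thesis using that j(1,2) a(4-) unfolding centre_at_def shift5 add1_mod5 a(1-3)
        by (elim offset_cases; hypsubst; simp)
    qed
    ultimately show ?thesis using step[of s t] mid_cen(1) s t j(1) by simp
  next
    case cen_cen
    have "p' = p \<and> centre_at t k s"
      using corner_eq_Cen[OF p' p t] cen_cen e1 by metis
    moreover have "p' = p \<and> centre_at t (k + 1) (s + 4)"
      using corner_eq_Cen[OF p' p t] cen_cen e2 by metis
    moreover have "t \<noteq> 0 \<and> s mod 5 = t mod 5" if "centre_at t k s"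
      "centre_at t (k + 1) (s + 4)"
    proof -
      obtain a b c where a: "s mod 5 = a" "k mod 5 = b" "t mod 5 = c" "a < 5" "b < 5" "c < 5"
        by simp
      show ?thesis using that a(4-) unfolding centre_at_def shift5 add1_mod5 a(1-3)
        by (elim offset_cases; hypsubst; simp)
    qed
    ultimately have "p' = p \<and> t \<noteq> 0 \<and> s mod 5 = t mod 5" by metis
    then show ?thesis using step[of s t] cen_cen(1) s t by simp
  next
    case cen_mid
    have "corner n p s = corner n p (s + 4 + 1)" by (rule corner_cong) simp
    then have "corner n (t # p') (k + 1) = Mid {#corner n p (s + 4), corner n p (s + 4 + 1)#}"
      using cen_mid e2 by metis
    then obtain j where j: "t \<noteq> 0" "(k + 1) mod 5 = (t + 1) mod 5 \<and> j = t \<or>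
        (k + 1) mod 5 = (t + 4) mod 5 \<and> j = t + 4"
      "p' = p \<and> j mod 5 = (s + 4) mod 5 \<or> corner n p' j = corner n p (s + 4 + 1) \<and>
          corner n p' (j + 1) = corner n p (s + 4)"
      by (rule corner_eq_Mid[OF l p' p t])
    have "p' = p \<and> centre_at t k (s + 4)"
      using corner_eq_Cen[OF p' p t] cen_mid e1 by metis
    moreover have "s mod 5 = t mod 5" if "centre_at t k (s + 4)"
    proof -
      obtain a b c where a: "s mod 5 = a" "t mod 5 = b" "k mod 5 = c" "a < 5" "b < 5" "c < 5"
        by simp
      show ?thesis using that j(1,2) a(4-) unfolding centre_at_def shift5 add1_mod5 a(1-3)
        by (elim offset_cases; hypsubst; simp)
    qed
    ultimately show ?thesis using step[of s t] cen_mid(1) s t j(1) by simp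
  next
    case mid_old
    have k: "t \<noteq> 0 \<and> (k + 1) mod 5 = t mod 5 \<and> corner n p' t = corner n p s"
      using corner_eq_old[OF p' p t] mid_old e2 by metis
    have "corner n p s = corner n p (s + 4 + 1)" by (rule corner_cong) simp
    then have "corner n (t # p') k = Mid {#corner n p (s + 4), corner n p (s + 4 + 1)#}"
      using mid_old e1 by metis
    then obtain j where j: "t \<noteq> 0" "k mod 5 = (t + 1) mod 5 \<and> j = t \<or> k mod 5 = (t + 4) mod 5 \<and>
        j = t + 4"
      "p' = p \<and> j mod 5 = (s + 4) mod 5 \<or> corner n p' j = corner n p (s + 4 + 1) \<and>
          corner n p' (j + 1) = corner n p (s + 4)"
      by (rule corner_eq_Mid[OF l p' p t])
    have jt: "j = t + 4" using j(2) k by (cases k rule: mod5_cases; cases t rule: mod5_cases; auto simp: shift5)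
    have "corner n p s \<noteq> corner n p (s + 4)"
      using l p unfolding addressing_def by (metis neq_shift)
    moreover have "corner n p' (t + 4 + 1) = corner n p' t" by (rule corner_cong) simp
    ultimately have "p' = p \<and> (t + 4) mod 5 = (s + 4) mod 5" using j(3) k jt by metis
    moreover have "t mod 5 = s mod 5" if "(t + 4) mod 5 = (s + 4) mod 5"
      using that by (cases s rule: mod5_cases; cases t rule: mod5_cases; auto simp: shift5)
    ultimately show ?thesis using step[of s t] mid_old(1) s t j(1) by simp
  qed
  have A4: "k mod 5 = (r + 2) mod 5 \<or> k mod 5 = (r + 3) mod 5"
    if e1: "corner n (s # p) r = corner n (t # p') (k + 1)"
        and e2: "corner n (s # p) (r + 1) = corner n (t # p') k"
      and p: "addr n l p" and s: "s \<in> {0..5}" and p': "addr n l p'"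
          and t: "t \<in> {0..5}" for s p r t p' k
  proof -
    \<comment> \<open>Half edges carry the label of the parent edge, so the relation between the two
      labels is inherited from the parents.\<close>
    have outer: ?thesis if "r mod 5 = a mod 5" "k mod 5 = b mod 5"
      "corner n p a = corner n p' (b + 1)" "corner n p (a + 1) = corner n p' b" for a b
    proof -
      have "b mod 5 = (a + 2) mod 5 \<or> b mod 5 = (a + 3) mod 5"
        using l p p' that(3,4) unfolding addressing_def by metis
      then show ?thesis using that(1,2) by (metis mod_add_left_eq)
    qed
    show ?thesis
      using reversed_edge_cases[OF l p s p' t e1 e2]
    proof (elim disjE conjE exE, goal_cases)
      case (1 a b) then show ?case by (intro outer)
    next
      case (2 a b) then show ?case by (intro outer)
    next
      case 3 then show ?case by simp
    next
      case 4 then show ?case using shift_trans[of r s 2 3] by simp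
    next
      case 5 then show ?case using shift_trans[of r s 1 3] by simp
    next
      case 6 then show ?case using shift_trans[of r s 3 2] by simp
    qed
  qed
  show ?thesis unfolding addressing_def
  proof (intro allI impI conjI)
    fix q q' r k assume qq: "addr n (Suc l) q" "addr n (Suc l) q'"
    obtain s p where q: "q = s # p" "s \<in> {0..5}" "addr n l p" by (rule addr_SucE[OF qq(1)])
    obtain t p' where q': "q' = t # p'" "t \<in> {0..5}" "addr n l p'" by (rule addr_SucE[OF qq(2)])
    show "r mod 5 = k mod 5" if "corner n q r = corner n q k"
      using A1 that q by blast
    show "q = q'" if "corner n q r = corner n q' r"
      using A2 that q q' by blast
    show "q = q'" if "corner n q r = corner n q' k \<and> corner n q (r + 1) = corner n q' (k + 1)"
      using A3 that q q' by blast
    show "k mod 5 = (r + 2) mod 5 \<or> k mod 5 = (r + 3) mod 5"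
      if "corner n q r = corner n q' (k + 1) \<and> corner n q (r + 1) = corner n q' k"
      using A4 that q q' by blast
  qed
qed

lemma addressing: "addressing n l"
  by (induction l) (simp_all add: addressing_0 addressing_Suc)

text \<open>A route out of \<open>T\<^sub>n\<close>: from the central subtile to a petal, round the petals to the one
  containing the first half of the exit edge of the parent, and out through it. Ranks increase along it.\<close>

fun exit_edge :: "nat list \<Rightarrow> nat" where
  "exit_edge [] = 0"
| "exit_edge (s # q) = (if s = 0 then 0 else if s mod 5 = exit_edge q mod 5 then s else s + 1)"

text \<open>A base-6 numeral whose leading digits belong to the outermost tiles. Digit 0 is the
  central subtile; the petals get 1 to 5, with 5 for the petal containing the exit. As 4 is -1
  modulo 5, the residue counts the petals still to be passed.\<close>

fun exit_rank :: "nat list \<Rightarrow> nat" where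
  "exit_rank [] = 0"
| "exit_rank (s # q) = 6 * exit_rank q + (if s = 0 then 0 else 5 - (exit_edge q + 4 * s) mod 5)"

text \<open>Leaving the parent raises the parent's rank, which outweighs the units digit because
  that is at most 5; moving inside the parent raises the units digit itself. The base case is void,
  since no tile lies across an edge of T_n.\<close>

lemma exit_rank_less:
  assumes "addr n l q" "addr n l q'"
    "corner n q (exit_edge q) = corner n q' (k + 1)" "corner n q (exit_edge q + 1) = corner n q' k"
  shows "exit_rank q < exit_rank q'"
  using assms
proof (induction l arbitrary: q q' k)
  case 0
  then have "corner n [] 0 = corner n [] (k + 1)" "corner n [] 1 = corner n [] k"
    by (simp_all add: addr_0)
  then have "0 mod 5 = (k + 1) mod 5" "1 mod 5 = k mod 5"
    using addressing[of n 0] unfolding addressing_def addr_0 by metis+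
  then show ?case by (cases k rule: mod5_cases; auto simp: shift5)
next
  case (Suc l)
  obtain s p where q: "q = s # p" "s \<in> {0..5}" "addr n l p" by (rule addr_SucE[OF Suc.prems(1)])
  obtain t p' where q': "q' = t # p'" "t \<in> {0..5}" "addr n l p'"
      by (rule addr_SucE[OF Suc.prems(2)])
  have e: "corner n (s # p) (exit_edge q) = corner n (t # p') (k + 1)"
    "corner n (s # p) (exit_edge q + 1) = corner n (t # p') k"
    using Suc.prems(3,4) unfolding q(1) q'(1) .
  note c = reversed_edge_cases[OF addressing q(3,2) q'(3,2)]
  have pos: "5 - m mod 5 \<le> 5" "5 - m mod 5 > 0" for m :: nat by simp_all
  consider (zero) "s = 0" | (exit) "s \<noteq> 0" "s mod 5 = exit_edge p mod 5" | (inside) "s \<noteq> 0"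
      "s mod 5 \<noteq> exit_edge p mod 5"
    by blast
  then show ?case
  proof cases
    case zero
    then have "p' = p \<and> t \<noteq> 0" using c[OF e] by metis
    then show ?thesis using zero q(1) q'(1) pos by simp
  next
    case exit
    then have x: "exit_edge q = s" unfolding q(1) by simp
    obtain b where "corner n p s = corner n p' (b + 1)" "corner n p (s + 1) = corner n p' b"
      using c[OF e[unfolded x]] exit(1) by (elim disjE conjE exE) (metis neq_shift shift_neq)+
    moreover have "corner n p s = corner n p (exit_edge p)"
        "corner n p (s + 1) = corner n p (exit_edge p + 1)"
      using exit(2) by (auto intro!: corner_cong simp: mod_Suc)
    ultimately have "exit_rank p < exit_rank p'" using Suc.IH[OF q(3) q'(3)] by metis
    moreover have "exit_rank q \<le> 6 * exit_rank p + 5" unfolding q(1) by simp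
    moreover have "6 * exit_rank p' \<le> exit_rank q'" unfolding q'(1) by simp
    ultimately show ?thesis by linarith
  next
    case inside
    then have x: "exit_edge q = s + 1" unfolding q(1) by simp
    have pt: "p' = p \<and> t \<noteq> 0 \<and> t mod 5 = (s + 1) mod 5"
      using c[OF e[unfolded x]] inside(1) by (elim disjE conjE exE) (metis neq_shift shift_neq)+
    \<comment> \<open>Passing to the next petal shortens the remaining way by one; the count does
      not wrap around because s is not the exit petal.\<close>
    have "5 - (x + 4 * s) mod 5 < 5 - (x + 4 * t) mod 5"
      if "s mod 5 \<noteq> x mod 5" "t mod 5 = (s + 1) mod 5" for x
    proof -
      have m: "(x + 4 * y) mod 5 = (x mod 5 + 4 * (y mod 5)) mod 5" for y
        by (subst mod_add_eq[symmetric], subst mod_mult_right_eq[symmetric], rule mod_add_right_eq)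
      obtain a b where ab: "x mod 5 = a" "s mod 5 = b" "a < 5" "b < 5" by simp
      show ?thesis using that(1) ab(3,4) unfolding m that(2) shift5 add1_mod5 ab(1,2)
        by (elim offset_cases; hypsubst; simp)
    qed
    then have "5 - (exit_edge p + 4 * s) mod 5 < 5 - (exit_edge p + 4 * t) mod 5"
      using inside(2) pt by blast
    moreover have "exit_rank q = 6 * exit_rank p + (5 - (exit_edge p + 4 * s) mod 5)"
      using inside(1) unfolding q(1) by simp
    moreover have "exit_rank q' = 6 * exit_rank p + (5 - (exit_edge p + 4 * t) mod 5)"
      using pt unfolding q'(1) by simp
    ultimately show ?thesis by linarith
  qed
qed

section \<open>Faces of the tiling\<close>

lemma addressingD:
  assumes "addr n l q" "addr n l q'"
  shows "corner n q r = corner n q s \<Longrightarrow> r mod 5 = s mod 5"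
    and "corner n q r = corner n q' r \<Longrightarrow> q = q'"
    and "corner n q r = corner n q' s \<Longrightarrow> corner n q (r + 1) = corner n q' (s + 1) \<Longrightarrow> q = q'"
    and "corner n q r = corner n q' (s + 1) \<Longrightarrow> corner n q (r + 1) = corner n q' s \<Longrightarrow>
        s mod 5 = (r + 2) mod 5 \<or> s mod 5 = (r + 3) mod 5"
  using addressing[of n l] assms unfolding addressing_def by blast+

text \<open>Canonical addresses pay off here: embedding T_n as the central child of T_(n+1) leaves
  every vertex name unchanged.\<close>

lemma corner_embed: "corner (Suc n) (p @ [0]) j = corner n p j"
proof -
  have canon: "canon (Suc n) (q @ [0]) = canon n q" for q
    unfolding canon_def Let_def by simp
  have "canon (Suc n) [] = (Suc n, [])" by (simp add: canon_def)
  then show ?thesis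
    by (induction p arbitrary: j) (simp_all add: canon Let_def)
qed

lemma addr_embed: "addr n n p \<Longrightarrow> addr (Suc n) (Suc n) (p @ [0])"
  by (auto simp: addr_def)

lemma K_faces_level:
  assumes "f \<in> K_faces"
  obtains m where "\<And>n. n \<ge> m \<Longrightarrow> \<exists>p. addr n n p \<and> f = map (corner n p) [0..<5]"
proof -
  obtain m p where f: "f = map (corner m p) [0..<5]" and p: "addr m m p"
    using assms unfolding K_faces_def addr_def by auto
  have "\<exists>p. addr n n p \<and> f = map (corner n p) [0..<5]" if "n \<ge> m" for n
    using that
  proof (induction n rule: dec_induct)
    case base
    then show ?case using f p by blast
  next
    case (step n)
    then obtain q where "addr n n q" "f = map (corner n q) [0..<5]" by blast
    moreover have "corner (Suc n) (q @ [0]) = corner n q" by (rule ext) (rule corner_embed)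
    ultimately have "addr (Suc n) (Suc n) (q @ [0]) \<and> f = map (corner (Suc n) (q @ [0])) [0..<5]"
      using addr_embed by metis
    then show ?case by blast
  qed
  then show thesis by (rule that)
qed

text \<open>The address results compare tiles of one T_n, so faces are first lifted to a level above
  all of theirs; finiteness provides that level.\<close>

lemma K_faces_common_level:
  assumes "finite Z" "Z \<subseteq> K_faces"
  obtains n P where "\<And>f. f \<in> Z \<Longrightarrow> addr n n (P f)" "\<And>f r. f \<in> Z \<Longrightarrow> length f = 5"
    "\<And>f r. f \<in> Z \<Longrightarrow> r < 5 \<Longrightarrow> f ! r = corner n (P f) r"
    "\<And>f r. f \<in> Z \<Longrightarrow> f ! (Suc r mod 5) = corner n (P f) (r + 1)"
    "\<And>f g. f \<in> Z \<Longrightarrow> g \<in> Z \<Longrightarrow> P f = P g \<Longrightarrow> f = g"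
proof -
  have "\<exists>m. \<forall>f\<in>Z. \<forall>n\<ge>m. \<exists>p. addr n n p \<and> f = map (corner n p) [0..<5]"
    using assms
  proof (induction Z rule: finite_induct)
    case (insert f Z)
    then obtain m where "\<forall>f\<in>Z. \<forall>n\<ge>m. \<exists>p. addr n n p \<and> f = map (corner n p) [0..<5]" by auto
    moreover obtain m' where "\<forall>n\<ge>m'. \<exists>p. addr n n p \<and> f = map (corner n p) [0..<5]"
      using K_faces_level insert.prems by (metis insert_subset)
    ultimately have "\<forall>g\<in>insert f Z. \<forall>n\<ge>max m m'. \<exists>p. addr n n p \<and> g = map (corner n p) [0..<5]"
      by simp
    then show ?case by blast
  qed simp
  then obtain n where "\<forall>f\<in>Z. \<exists>p. addr n n p \<and> f = map (corner n p) [0..<5]" by blast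
  then obtain P where P: "\<And>f. f \<in> Z \<Longrightarrow> addr n n (P f) \<and> f = map (corner n (P f)) [0..<5]"
    by metis
  have nth: "f ! r = corner n (P f) r" if "f \<in> Z" "r < 5" for f r
  proof -
    have "f ! r = map (corner n (P f)) [0..<5] ! r" using P that(1) by metis
    then show ?thesis using that(2) by simp
  qed
  show thesis
  proof
    fix f assume f: "f \<in> Z"
    show "addr n n (P f)" using P f by blast
    have "length f = length (map (corner n (P f)) [0..<5])" using P f by metis
    then show "length f = 5" by simp
    show "f ! r = corner n (P f) r" if "r < 5" for r using nth f that .
    show "f ! (Suc r mod 5) = corner n (P f) (r + 1)" for r
      using nth[OF f, of "Suc r mod 5"] corner_cong[of "Suc r mod 5" "r + 1" n "P f"] by simp
    show "f = g" if "g \<in> Z" "P f = P g" for g using P f that by metis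
  qed
qed

lemma K_face_distinct:
  assumes "f \<in> K_faces"
  shows "length f = 5" "distinct f"
proof -
  obtain n P where P: "addr n n (P f)" "length f = 5" "\<And>r. r < 5 \<Longrightarrow> f ! r = corner n (P f) r"
    using K_faces_common_level[of "{f}"] assms
      by (metis empty_subsetI finite.emptyI finite_insert insert_subset singletonI)
  show "length f = 5" by fact
  have "r = s" if "f ! r = f ! s" "r < 5" "s < 5" for r s
  proof -
    have "r mod 5 = s mod 5"
      using addressingD(1)[OF P(1) P(1), of r s] that(1)
        unfolding P(3)[OF that(2)] P(3)[OF that(3)] .
    then show ?thesis using that by simp
  qed
  then show "distinct f" using P(2) by (metis distinct_conv_nth)
qed

lemma K_face_pair:
  assumes "f \<in> K_faces" "g \<in> K_faces"
  shows K_face_unique: "r < 5 \<Longrightarrow> f ! r = g ! r \<Longrightarrow> f = g"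
    and K_face_directed_edge: "r < 5 \<Longrightarrow> s < 5 \<Longrightarrow> f ! r = g ! s \<Longrightarrow>
      f ! (Suc r mod 5) = g ! (Suc s mod 5) \<Longrightarrow> f = g"
    and K_face_reversed_edge: "r < 5 \<Longrightarrow> s < 5 \<Longrightarrow> f ! r = g ! (Suc s mod 5) \<Longrightarrow>
      f ! (Suc r mod 5) = g ! s \<Longrightarrow> r \<noteq> s"
proof -
  obtain n P where P: "addr n n (P f)" "addr n n (P g)"
    "\<And>r. r < 5 \<Longrightarrow> f ! r = corner n (P f) r" "\<And>r. r < 5 \<Longrightarrow> g ! r = corner n (P g) r"
    "\<And>r. f ! (Suc r mod 5) = corner n (P f) (r + 1)"
        "\<And>r. g ! (Suc r mod 5) = corner n (P g) (r + 1)"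
    "P f = P g \<Longrightarrow> f = g"
  proof (rule K_faces_common_level[of "{f, g}"])
    fix n P
    assume A: "\<And>h. h \<in> {f, g} \<Longrightarrow> addr n n (P h)" "\<And>h r. h \<in> {f, g} \<Longrightarrow> length h = 5"
      "\<And>h r. h \<in> {f, g} \<Longrightarrow> r < 5 \<Longrightarrow> h ! r = corner n (P h) r"
      "\<And>h r. h \<in> {f, g} \<Longrightarrow> h ! (Suc r mod 5) = corner n (P h) (r + 1)"
      "\<And>h k. h \<in> {f, g} \<Longrightarrow> k \<in> {f, g} \<Longrightarrow> P h = P k \<Longrightarrow> h = k"
    have m: "f \<in> {f, g}" "g \<in> {f, g}" by simp_all
    show thesis
      by (rule that[OF A(1)[OF m(1)] A(1)[OF m(2)] A(3)[OF m(1)] A(3)[OF m(2)] A(4)[OF m(1)] A(4)[OF m(2)] A(5)[OF m]])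
  qed (use assms in auto)
  show "f = g" if "r < 5" "f ! r = g ! r"
    using that(2) addressingD(2)[OF P(1,2), of r] unfolding P(3)[OF that(1)] P(4)[OF that(1)]
    by (intro P(7))
  show "f = g" if "r < 5" "s < 5" "f ! r = g ! s" "f ! (Suc r mod 5) = g ! (Suc s mod 5)"
    using that(3,4) addressingD(3)[OF P(1,2), of r s]
      unfolding P(3)[OF that(1)] P(4)[OF that(2)] P(5,6)
    by (intro P(7))
  show "r \<noteq> s" if "r < 5" "s < 5" "f ! r = g ! (Suc s mod 5)" "f ! (Suc r mod 5) = g ! s"
    using that(3,4) addressingD(4)[OF P(1,2), of r s] shift_neq[of s]
    unfolding P(3)[OF that(1)] P(4)[OF that(2)] P(5,6) by metis
qed

text \<open>A face of maximal \<open>exit_rank\<close> works: a face of \<open>Z\<close> across its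
  exit edge would have larger rank, and one running along that edge in the same direction is the
  face itself.\<close>

lemma K_faces_exposed_edge:
  assumes "finite Z" "Z \<subseteq> K_faces" "Z \<noteq> {}"
  obtains f r where "f \<in> Z" "r < 5"
    "\<And>g s. g \<in> Z \<Longrightarrow> s < 5 \<Longrightarrow> {f ! r, f ! (Suc r mod 5)} = {g ! s, g ! (Suc s mod 5)} \<Longrightarrow> g = f"
proof -
  obtain n P where P: "\<And>f. f \<in> Z \<Longrightarrow> addr n n (P f)"
    "\<And>f r. f \<in> Z \<Longrightarrow> r < 5 \<Longrightarrow> f ! r = corner n (P f) r"
    "\<And>f r. f \<in> Z \<Longrightarrow> f ! (Suc r mod 5) = corner n (P f) (r + 1)"
    using K_faces_common_level[OF assms(1,2)] by metis
  define f where "f = (ARG_MAX (exit_rank \<circ> P) f. f \<in> Z)"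
  have f: "f \<in> Z" "\<And>g. g \<in> Z \<Longrightarrow> exit_rank (P g) \<le> exit_rank (P f)"
  proof -
    obtain g where g: "g \<in> Z" using assms(3) by blast
    have b: "\<forall>h. h \<in> Z \<longrightarrow> (exit_rank \<circ> P) h < Suc (Max ((exit_rank \<circ> P) ` Z))"
      using assms(1) by (simp add: le_imp_less_Suc)
    show "f \<in> Z" unfolding f_def by (rule arg_max_natI[of "\<lambda>h. h \<in> Z", OF g b])
    show "exit_rank (P h) \<le> exit_rank (P f)" if "h \<in> Z" for h
      using arg_max_nat_le[of "\<lambda>h. h \<in> Z", OF that b] unfolding f_def comp_def by simp
  qed
  define e where "e = exit_edge (P f)"
  define r where "r = e mod 5"
  have r: "r < 5" unfolding r_def by simp
  have fr: "f ! r = corner n (P f) e" "f ! (Suc r mod 5) = corner n (P f) (e + 1)"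
    using P(2)[OF f(1) r] P(3)[OF f(1), of r] corner_cong[of r e n "P f"] corner_cong[of "r + 1"
        "e + 1" n "P f"]
    unfolding r_def by (simp_all add: mod_Suc_eq)
  show thesis
  proof (rule that[OF f(1) r])
    fix g s assume g: "g \<in> Z" "s < 5" and eq:
        "{f ! r, f ! (Suc r mod 5)} = {g ! s, g ! (Suc s mod 5)}"
    consider "f ! r = g ! s" "f ! (Suc r mod 5) = g ! (Suc s mod 5)"
      | "f ! r = g ! (Suc s mod 5)" "f ! (Suc r mod 5) = g ! s"
      using eq by (metis doubleton_eq_iff)
    then show "g = f"
    proof cases
      case 1
      then show ?thesis using K_face_directed_edge[of f g r s] f(1) g r assms(2) by blast
    next
      case 2
      then have "exit_rank (P f) < exit_rank (P g)"
        using exit_rank_less[OF P(1)[OF f(1)] P(1)[OF g(1)], of s] P(2,3) g fr unfolding e_def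
          by metis
      then show ?thesis using f(2)[OF g(1)] by simp
    qed
  qed
qed

lemma coboundary_surj:
  assumes "finite P" "P \<subseteq> K_faces"
  obtains v :: "vert \<Rightarrow> vert \<Rightarrow> int" where "\<And>a b. v a b = - v b a"
    "\<And>f. f \<in> P \<Longrightarrow> (\<Sum>r<5. v (f ! r) (f ! (Suc r mod 5))) = w f"
proof -
  have "\<exists>v :: vert \<Rightarrow> vert \<Rightarrow> int. (\<forall>a b. v a b = - v b a) \<and>
      (\<forall>f\<in>P. (\<Sum>r<5. v (f ! r) (f ! (Suc r mod 5))) = w f)"
    using assms
  proof (induction P rule: finite_psubset_induct)
    case (psubset P)
    show ?case
    proof (cases "P = {}")
      case True
      then show ?thesis by (intro exI[of _ "\<lambda>a b. 0"]) simp
    next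
      case False
      obtain f r where f: "f \<in> P" "r < 5"
        and ex: "\<And>g s. g \<in> P \<Longrightarrow> s < 5 \<Longrightarrow> {f ! r, f ! (Suc r mod 5)} = {g ! s, g ! (Suc s mod 5)} \<Longrightarrow>
            g = f"
        using K_faces_exposed_edge[OF psubset.hyps(1) psubset.prems False] by metis
      have "P - {f} \<subset> P" "P - {f} \<subseteq> K_faces" using f psubset.prems by auto
      from psubset.IH[OF this] obtain v where v: "\<And>a b. v a b = - v b a"
        "\<And>g. g \<in> P - {f} \<Longrightarrow> (\<Sum>r<5. v (g ! r) (g ! (Suc r mod 5))) = w g" by blast
      define x y c where "x = f ! r" and "y = f ! (Suc r mod 5)"
        and "c = w f - (\<Sum>r<5. v (f ! r) (f ! (Suc r mod 5)))"
      \<comment> \<open>The correction lives on the exposed edge alone, with opposite signs for its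
        two directions: it repairs the sum at \<open>f\<close> and leaves every other face
        untouched.\<close>
      define b where "b = (\<lambda>p q. (if p = x \<and> q = y then c else 0) - (if p = y \<and>
          q = x then c else (0::int)))"
      have b0: "b p q = 0" if "\<not> (p = x \<and> q = y)" "\<not> (p = y \<and> q = x)" for p q
        unfolding b_def if_not_P[OF that(1)] if_not_P[OF that(2)] by simp
      have d: "length f = 5" "distinct f" using K_face_distinct f psubset.prems by blast+
      have "b (f ! s) (f ! (Suc s mod 5)) = (if s = r then c else 0)" if "s < 5" for s
      proof -
        have inj: "f ! i = f ! j \<longleftrightarrow> i = j" if "i < 5" "j < 5" for i j
          using d that by (metis nth_eq_iff_index_eq)
        have h: "f ! s = x \<longleftrightarrow> s = r" "s = r \<Longrightarrow> f ! (Suc s mod 5) = y"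
          unfolding x_def y_def using inj[OF that f(2)] by simp_all
        have "\<not> (s = Suc r mod 5 \<and> Suc s mod 5 = r)"
          using f(2) that by (elim offset_cases; simp)
        then have "\<not> (f ! s = y \<and> f ! (Suc s mod 5) = x)"
          unfolding x_def y_def using inj[of s "Suc r mod 5"] inj[of "Suc s mod 5" r] that f(2)
            by simp
        then show ?thesis using h unfolding b_def by (cases "s = r") auto
      qed
      then have bf: "(\<Sum>s<5. b (f ! s) (f ! (Suc s mod 5))) = c"
        using f(2) by simp
      have bg: "b (g ! s) (g ! (Suc s mod 5)) = 0" if "g \<in> P - {f}" "s < 5" for g s
      proof (rule ccontr)
        assume "b (g ! s) (g ! (Suc s mod 5)) \<noteq> 0"
        then have "g ! s = x \<and> g ! (Suc s mod 5) = y \<or> g ! s = y \<and> g ! (Suc s mod 5) = x"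
          using b0 by blast
        then have "{f ! r, f ! (Suc r mod 5)} = {g ! s, g ! (Suc s mod 5)}"
          unfolding x_def[symmetric] y_def[symmetric] doubleton_eq_iff by metis
        then show False using ex[of g s] that by blast
      qed
      have h1: "(\<Sum>s<5. v (g ! s) (g ! (Suc s mod 5)) + b (g ! s) (g ! (Suc s mod 5))) = w g"
          if "g \<in> P" for g
      proof (cases "g = f")
        case True
        then show ?thesis using bf by (simp add: sum.distrib c_def)
      next
        case False
        then show ?thesis using bg[of g] v(2)[of g] that by (simp add: sum.distrib)
      qed
      have h2: "v p q + b p q = - (v q p + b q p)" for p q
      proof -
        have "b p q = - b q p" unfolding b_def by (simp add: conj_commute)
        then show ?thesis using v(1)[of p q] by linarith
      qed
      show ?thesis
        by (rule exI[of _ "\<lambda>p q. v p q + b p q"], intro conjI allI ballI, rule h2, rule h1)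
    qed
  qed
  then show thesis using that by blast
qed

section \<open>Integral cocycles on a simply connected patch\<close>

text \<open>Closed cells are what lets a map given cell by cell be glued continuously. Distinct
  corners make the values at \<open>a\<close>, \<open>b\<close>, \<open>c\<close> the barycentric
  coordinates.\<close>

lemma closed_tri:
  assumes "a \<noteq> b" "a \<noteq> c" "b \<noteq> c"
  shows "closed (tri a b c)"
proof -
  have "tri a b c = {y. 0 \<le> y a} \<inter> {y. 0 \<le> y b} \<inter> {y. 0 \<le> y c} \<inter> {y. y a + y b + y c = 1} \<inter>
      (\<Inter>z\<in>-{a, b, c}. {y. y z = 0})" (is "_ = ?R")
  proof (intro equalityI subsetI)
    fix y assume "y \<in> tri a b c"
    then obtain \<alpha> \<beta> \<gamma> where "y = (\<lambda>z. \<alpha> * delta a z + \<beta> * delta b z + \<gamma> * delta c z)"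
      "\<alpha> \<ge> 0" "\<beta> \<ge> 0" "\<gamma> \<ge> 0" "\<alpha> + \<beta> + \<gamma> = 1"
      unfolding tri_def by blast
    then show "y \<in> ?R" using assms by (auto simp: delta_def)
  next
    fix y assume y: "y \<in> ?R"
    have "y = (\<lambda>z. y a * delta a z + y b * delta b z + y c * delta c z)"
      using y assms by (intro ext) (auto simp: delta_def)
    then show "y \<in> tri a b c" using y unfolding tri_def by blast
  qed
  moreover have "continuous_on UNIV (\<lambda>y :: 'a \<Rightarrow> real. y i)" for i by simp
  then have "closed ?R"
    by (intro closed_Int closed_INT ballI closed_Collect_le closed_Collect_eq continuous_intros) 
  ultimately show ?thesis by simp
qed

definition face_cell :: "vert list \<Rightarrow> ((vert + vert list) \<Rightarrow> real) set" where
  "face_cell f = (\<Union>r<5. tri (Inr f) (Inl (f ! r)) (Inl (f ! (Suc r mod 5))))"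

lemma realization_eq: "realization P = (\<Union>f\<in>P. face_cell f)"
  unfolding realization_def face_cell_def by simp

lemma nth_next_neq:
  assumes "length f = 5" "distinct f" "r < 5"
  shows "f ! r \<noteq> f ! (Suc r mod 5)"
proof -
  have "r \<noteq> Suc r mod 5" using assms(3) by (elim offset_cases; simp)
  then show ?thesis using assms nth_eq_iff_index_eq[of f r "Suc r mod 5"] by simp
qed

lemma face_cell_cases:
  assumes "y \<in> face_cell f"
  obtains r \<beta> \<gamma> where "r < 5" "\<beta> \<ge> 0" "\<gamma> \<ge> 0" "y (Inr f) + \<beta> + \<gamma> = 1"
    "\<forall>g. g \<noteq> f \<longrightarrow> y (Inr g) = 0"
    "\<forall>v. y (Inl v) = \<beta> * delta (f ! r) v + \<gamma> * delta (f ! (Suc r mod 5)) v"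
  using assms unfolding face_cell_def tri_def delta_def by auto

text \<open>The potential \<open>W f\<close> extended linearly over the cone on \<open>f\<close>, with value 0 at the cone point; on
  shared edges two such extensions differ by an integer, so \<open>exp (2 \<pi> \<i> angle)\<close> is globally defined.\<close>

definition angle :: "(vert list \<Rightarrow> vert \<Rightarrow> int) \<Rightarrow> vert list \<Rightarrow> ((vert + vert list) \<Rightarrow> real) \<Rightarrow> real" where
  "angle W f y = (\<Sum>v\<in>set f. y (Inl v) * W f v)"

lemma continuous_on_angle: "continuous_on S (angle W f)"
proof -
  have "continuous_on UNIV (\<lambda>y :: (vert + vert list) \<Rightarrow> real. y i)" for i by simp
  then have "continuous_on UNIV (angle W f)" unfolding angle_def by (intro continuous_intros)
  then show ?thesis using continuous_on_subset by blast
qed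

lemma angle_eq:
  assumes "\<And>v. y (Inl v) = \<beta> * delta a v + \<gamma> * delta b v" "a \<in> set f" "b \<in> set f"
  shows "angle W f y = \<beta> * W f a + \<gamma> * W f b"
proof -
  have "angle W f y = (\<Sum>v\<in>set f. (if v = a then \<beta> * W f a else 0) + (if v =
      b then \<gamma> * W f b else 0))"
    unfolding angle_def assms(1) by (intro sum.cong) (auto simp: delta_def algebra_simps)
  then show ?thesis using assms(2,3) by (simp add: sum.distrib)
qed

text \<open>Only increments along a common edge are compared: the potentials of two faces may differ
  there by an integer constant, which the exponential does not see.\<close>

definition compatible_potentials :: "vert list set \<Rightarrow> (vert list \<Rightarrow> vert \<Rightarrow> int) \<Rightarrow> bool" where
  "compatible_potentials P W \<longleftrightarrow> (\<forall>f\<in>P. \<forall>g\<in>P. \<forall>r<5. \<forall>s<5.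
     {f ! r, f ! (Suc r mod 5)} = {g ! s, g ! (Suc s mod 5)} \<longrightarrow>
     W f (f ! (Suc r mod 5)) - W f (f ! r) = W g (f ! (Suc r mod 5)) - W g (f ! r))"

text \<open>A point of two different cells has cone coordinates 0, so it lies on a boundary edge of
  each. If these edges coincide, the angles differ by the integer constant of that edge; otherwise
  the point is a vertex and both angles are integers.\<close>

lemma angle_overlap:
  assumes "compatible_potentials P W" "f \<in> P" "g \<in> P"
    and fg: "length f = 5" "distinct f" "length g = 5" "distinct g"
    and y: "y \<in> face_cell f" "y \<in> face_cell g"
  shows "angle W f y - angle W g y \<in> \<int>"
proof (cases "f = g")
  case True
  then show ?thesis by simp
next
  case False
  obtain r \<beta> \<gamma> where r: "r < 5" "\<beta> \<ge> 0" "\<gamma> \<ge> 0" "y (Inr f) + \<beta> + \<gamma> = 1"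
    "\<forall>g. g \<noteq> f \<longrightarrow> y (Inr g) = 0"
    "\<forall>v. y (Inl v) = \<beta> * delta (f ! r) v + \<gamma> * delta (f ! (Suc r mod 5)) v"
    by (rule face_cell_cases[OF y(1)])
  obtain s \<beta>' \<gamma>' where s: "s < 5" "\<beta>' \<ge> 0" "\<gamma>' \<ge> 0" "y (Inr g) + \<beta>' + \<gamma>' = 1"
    "\<forall>f. f \<noteq> g \<longrightarrow> y (Inr f) = 0"
    "\<forall>v. y (Inl v) = \<beta>' * delta (g ! s) v + \<gamma>' * delta (g ! (Suc s mod 5)) v"
    by (rule face_cell_cases[OF y(2)])
  have sum: "\<beta> + \<gamma> = 1" "\<beta>' + \<gamma>' = 1" using r(4,5) s(4,5) False by force+
  define a b a' b' where "a = f ! r" and "b = f ! (Suc r mod 5)" and "a' = g ! s" and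
      "b' = g ! (Suc s mod 5)"
  note d = a_def[symmetric] b_def[symmetric] a'_def[symmetric] b'_def[symmetric]
  have ne: "a \<noteq> b" "a' \<noteq> b'"
    using nth_next_neq fg r(1) s(1) unfolding a_def b_def a'_def b'_def by blast+
  note yf = r(6)[unfolded d, rule_format] and yg = s(6)[unfolded d, rule_format]
  have af: "angle W f y = \<beta> * W f a + \<gamma> * W f b"
    by (rule angle_eq[OF yf]) (use fg r(1) in \<open>simp_all add: a_def b_def\<close>)
  have ag: "angle W g y = \<beta>' * W g a' + \<gamma>' * W g b'"
    by (rule angle_eq[OF yg]) (use fg s(1) in \<open>simp_all add: a'_def b'_def\<close>)
  show ?thesis
  proof (cases "{a, b} = {a', b'}")
    case True
    have W: "W f b - W f a = W g b - W g a"
      using assms(1-3) r(1) s(1) True unfolding compatible_potentials_def a_def b_def a'_def b'_def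
        by blast
    have "angle W g y = \<beta> * W g a + \<gamma> * W g b"
    proof (cases "a = a'")
      case t: True
      then have "b = b'" using True ne by (metis doubleton_eq_iff)
      then show ?thesis using yf[of a] yg[of a] yf[of b] yg[of b] ne t ag by (simp add: delta_def)
    next
      case False
      then have "a = b'" "b = a'" using True by (metis doubleton_eq_iff)+
      then show ?thesis using yf[of a] yg[of a] yf[of b] yg[of b] ne ag by (simp add: delta_def)
    qed
    moreover have "real_of_int (W g b) = W f b - W f a + W g a" using W by linarith
    ultimately have "angle W f y - angle W g y = (\<beta> + \<gamma>) * (W f a - W g a)"
      using af by (simp add: algebra_simps)
    then show ?thesis unfolding sum by simp
  next
    case False
    have *: "\<beta> \<in> {0, 1} \<and> \<gamma> \<in> {0, 1} \<and> \<beta>' \<in> {0, 1} \<and> \<gamma>' \<in> {0, 1}"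
    proof -
      have 1: "y (Inl a) = \<beta>" "y (Inl b) = \<gamma>" "y (Inl a') = \<beta>'" "y (Inl b') = \<gamma>'"
        using yf[of a] yf[of b] yg[of a'] yg[of b'] ne by (simp_all add: delta_def)
      have 2: "v \<notin> {a, b} \<Longrightarrow> y (Inl v) = 0" "v \<notin> {a', b'} \<Longrightarrow> y (Inl v) = 0" for v
        using yf[of v] yg[of v] by (auto simp: delta_def)
      have "a \<notin> {a', b'} \<or> b \<notin> {a', b'}" "a' \<notin> {a, b} \<or> b' \<notin> {a, b}"
        using False ne by auto
      then have "\<beta> = 0 \<or> \<gamma> = 0" "\<beta>' = 0 \<or> \<gamma>' = 0" using 1 2 by metis+
      then show ?thesis using sum by auto
    qed
    then have "angle W f y \<in> \<int>" "angle W g y \<in> \<int>" unfolding af ag by auto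
    then show ?thesis by simp
  qed
qed

lemma cis_2pi_cong:
  assumes "x - y \<in> \<int>"
  shows "cis (2 * pi * x) = cis (2 * pi * y)"
proof -
  obtain k where "x = y + of_int k" using assms by (metis Ints_cases add.commute diff_add_cancel)
  then have "cis (2 * pi * x) = cis (2 * pi * y) * cis (2 * pi * of_int k)"
    by (simp add: cis_mult algebra_simps)
  then show ?thesis by (simp add: cis_multiple_2pi)
qed

text \<open>The local potentials define one map \<open>F\<close> into the punctured plane. Loops
  have winding number 0 under it, so the winding number along a path from a base vertex is a global
  potential.\<close>

lemma potentials_glue:
  assumes fin: "finite P" and P: "\<And>f. f \<in> P \<Longrightarrow> length f = 5 \<and> distinct f"
    and sc: "simply_connected (realization P)" and W: "compatible_potentials P W"
  obtains y :: "vert \<Rightarrow> int" where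
    "\<And>f r. f \<in> P \<Longrightarrow> r < 5 \<Longrightarrow> y (f ! (Suc r mod 5)) - y (f ! r) =
        W f (f ! (Suc r mod 5)) - W f (f ! r)"
proof (cases "P = {}")
  case True
  then show ?thesis using that by auto
next
  case False
  define X where "X = realization P"
  define F where "F = (\<lambda>y. cis (2 * pi * angle W (SOME f. f \<in> P \<and> y \<in> face_cell f) y))"
  have F: "F y = cis (2 * pi * angle W f y)" if "f \<in> P" "y \<in> face_cell f" for f y
  proof -
    let ?g = "SOME f. f \<in> P \<and> y \<in> face_cell f"
    have g: "?g \<in> P \<and> y \<in> face_cell ?g" by (rule someI_ex) (use that in blast)
    have "angle W ?g y - angle W f y \<in> \<int>"
      using g P[of ?g] P[OF that(1)] that by (intro angle_overlap[OF W]) simp_all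
    then show ?thesis unfolding F_def by (rule cis_2pi_cong)
  qed
  have contF: "continuous_on X F"
    unfolding X_def realization_eq
  proof (rule continuous_on_closed_Union[OF fin])
    fix f assume f: "f \<in> P"
    show "closed (face_cell f)" unfolding face_cell_def
      using nth_next_neq P[OF f] by (intro closed_UN ballI closed_tri) auto
    have "continuous_on (face_cell f) (\<lambda>y. cis (2 * pi * angle W f y))"
      by (intro continuous_intros continuous_on_angle)
    then show "continuous_on (face_cell f) F" using F[OF f] by (simp cong: continuous_on_cong)
  qed
  have F0: "F y \<noteq> 0" for y unfolding F_def by simp
  define e where "e = (\<lambda>v. delta (Inl v) :: (vert + vert list) \<Rightarrow> real)"
  define \<sigma> where "\<sigma> = (\<lambda>a b t z. (1 - t) * delta (Inl a :: vert + vert list) z + t * delta (Inl b) z)"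
  have \<sigma>_cell: "\<sigma> (f ! r) (f ! (Suc r mod 5)) t \<in> face_cell f" if "r < 5" "t \<in> {0..1}" for f r t
  proof -
    have "\<sigma> (f ! r) (f ! (Suc r mod 5)) t =
        (\<lambda>z. 0 * delta (Inr f) z + (1 - t) * delta (Inl (f ! r)) z + t * delta (Inl (f ! (Suc r mod 5))) z)"
      unfolding \<sigma>_def by simp
    then have "\<sigma> (f ! r) (f ! (Suc r mod 5)) t \<in> tri (Inr f) (Inl (f ! r)) (Inl (f ! (Suc r mod 5)))"
      unfolding tri_def using that(2) by fastforce
    then show ?thesis unfolding face_cell_def using that(1) by blast
  qed
  have \<sigma>_F: "F (\<sigma> (f ! r) (f ! (Suc r mod 5)) t) =
      cis (2 * pi * ((1 - t) * W f (f ! r) + t * W f (f ! (Suc r mod 5))))"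
    if "f \<in> P" "r < 5" "t \<in> {0..1}" for f r t
  proof -
    have "angle W f (\<sigma> (f ! r) (f ! (Suc r mod 5)) t) =
        (1 - t) * W f (f ! r) + t * W f (f ! (Suc r mod 5))"
      by (rule angle_eq) (use P that in \<open>auto simp: \<sigma>_def delta_def\<close>)
    then show ?thesis using F[OF that(1) \<sigma>_cell[OF that(2,3)]] by simp
  qed
  have \<sigma>_ends: "\<sigma> a b 0 = e a" "\<sigma> a b 1 = e b" for a b
    unfolding \<sigma>_def e_def by simp_all
  have \<sigma>_cont: "continuous_on S (\<sigma> a b)" for a b S
    unfolding \<sigma>_def by (intro continuous_intros)
  have e: "e (f ! r) \<in> X" "F (e (f ! r)) = 1" if "f \<in> P" "r < 5" for f r
  proof -
    show "e (f ! r) \<in> X"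
      using \<sigma>_cell[OF that(2), of 0] that(1) unfolding \<sigma>_ends X_def realization_eq by auto
    show "F (e (f ! r)) = 1"
      using \<sigma>_F[OF that, of 0] unfolding \<sigma>_ends by (simp add: cis_multiple_2pi)
  qed
  obtain f0 where f0: "f0 \<in> P" using False by blast
  define v0 where "v0 = f0 ! 0"
  have v0: "e v0 \<in> X" "F (e v0) = 1" using e[OF f0, of 0] unfolding v0_def by simp_all
  have null: "homotopic_loops X p (\<lambda>_. x)"
    if "path p" "path_image p \<subseteq> X" "pathfinish p = pathstart p" "x \<in> X" for p x
  proof -
    have "path (\<lambda>_::real. x)" "path_image (\<lambda>_. x) \<subseteq> X" "pathfinish (\<lambda>_. x) = pathstart (\<lambda>_. x)"
      using that(4) by (auto simp: path_def path_image_def pathfinish_def pathstart_def)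
    then show ?thesis using sc that(1-3) unfolding simply_connected_def X_def[symmetric] by blast
  qed
  \<comment> \<open>Path-connectedness comes from the same hypothesis: constant loops at the two
    points are homotopic, and the track of loop parameter 0 joins them.\<close>
  have "\<exists>\<gamma>. path \<gamma> \<and> path_image \<gamma> \<subseteq> X \<and> pathstart \<gamma> = e v0 \<and> pathfinish \<gamma> = x" if "x \<in> X" for x
  proof -
    have "homotopic_loops X (\<lambda>_. e v0) (\<lambda>_. x)"
      by (rule null) (use v0(1) that in \<open>auto simp: path_def path_image_def pathfinish_def pathstart_def\<close>)
    then obtain h where h: "continuous_on ({0..1::real} \<times> {0..1::real}) h"
        "h \<in> ({0..1} \<times> {0..1}) \<rightarrow> X"
      "\<And>t. t \<in> {0..1} \<Longrightarrow> h (0, t) = e v0" "\<And>t. t \<in> {0..1} \<Longrightarrow> h (1, t) = x"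
      unfolding homotopic_loops by blast
    have "continuous_on {0..1} (\<lambda>t. h (t, 0))"
      by (rule continuous_on_compose2[OF h(1)]) (auto intro!: continuous_intros)
    then show ?thesis using h
      by (intro exI[of _ "\<lambda>t. h (t, 0)"]) (auto simp: path_def path_image_def pathstart_def pathfinish_def)
  qed
  then obtain \<gamma> where \<gamma>: "\<And>x. x \<in> X \<Longrightarrow> path (\<gamma> x) \<and> path_image (\<gamma> x) \<subseteq> X \<and> pathstart (\<gamma> x) = e v0 \<and>
      pathfinish (\<gamma> x) = x"
    by metis
  have pathF: "path (F \<circ> p)" "0 \<notin> path_image (F \<circ> p)" if "path p" "path_image p \<subseteq> X" for p
  proof -
    show "path (F \<circ> p)" using that contF by (meson path_continuous_image continuous_on_subset)
    show "0 \<notin> path_image (F \<circ> p)" using F0 by (auto simp: path_image_def)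
  qed
  have loop: "winding_number (F \<circ> p) 0 = 0"
      if "path p" "path_image p \<subseteq> X" "pathfinish p = pathstart p" for p
  proof -
    have "homotopic_loops (-{0}) (F \<circ> p) (F \<circ> (\<lambda>_. e v0))"
      by (rule homotopic_loops_continuous_image[OF null[OF that v0(1)] contF]) (use F0 in auto)
    then have "winding_number (F \<circ> p) 0 = winding_number (F \<circ> (\<lambda>_. e v0)) 0"
      by (rule winding_number_homotopic_loops)
    also have "F \<circ> (\<lambda>_. e v0) = linepath 1 1"
      using v0(2) by (simp add: linepath_refl comp_def)
    also have "winding_number (linepath 1 1) 0 = 0" by (rule winding_number_trivial) simp
    finally show ?thesis .
  qed
  define N where "N = (\<lambda>v. winding_number (F \<circ> \<gamma> (e v)) 0)"
  \<comment> \<open>\<open>F\<close> is 1 at every vertex, so the image of a path between vertices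
    is a closed curve.\<close>
  have N_int: "N (f ! r) \<in> \<int>" if "f \<in> P" "r < 5" for f r
    unfolding N_def using \<gamma>[OF e(1)[OF that]] e(2)[OF that] v0(2) pathF
    by (intro integer_winding_number) (auto simp: pathfinish_compose pathstart_compose)
  have N_diff: "N (f ! (Suc r mod 5)) - N (f ! r) = of_int (W f (f ! (Suc r mod 5)) - W f (f ! r))"
    if f: "f \<in> P" and r: "r < 5" for f r
  proof -
    define a b where "a = f ! r" and "b = f ! (Suc r mod 5)"
    have X: "e a \<in> X" "e b \<in> X" using e(1)[OF f] r unfolding a_def b_def by simp_all
    have s: "path (\<sigma> a b)" "path_image (\<sigma> a b) \<subseteq> X" "pathstart (\<sigma> a b) = e a"
        "pathfinish (\<sigma> a b) = e b"
      using \<sigma>_cont \<sigma>_ends \<sigma>_cell[OF r, of _ f] f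
      unfolding path_def path_image_def pathstart_def pathfinish_def a_def b_def X_def realization_eq by auto
    let ?p = "\<gamma> (e a) +++ \<sigma> a b +++ reversepath (\<gamma> (e b))"
    note ga = \<gamma>[OF X(1)] and gb = \<gamma>[OF X(2)]
    have "winding_number (F \<circ> ?p) 0 = 0"
      by (rule loop) (use s ga gb in \<open>auto simp: path_image_join\<close>)
    moreover have "winding_number (F \<circ> ?p) 0 = N a + winding_number (F \<circ> \<sigma> a b) 0 - N b"
      unfolding path_compose_join path_compose_reversepath N_def
      using pathF[of "\<gamma> (e a)"] pathF[of "\<gamma> (e b)"] pathF[OF s(1,2)] s(3,4) ga gb
      by (simp add: winding_number_join winding_number_reversepath path_image_join not_in_path_image_join
          pathfinish_compose pathstart_compose)
    moreover have "winding_number (F \<circ> \<sigma> a b) 0 = of_int (W f b - W f a)"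
    proof -
      let ?l = "\<lambda>x. 2 * of_real pi * \<i> * of_int (W f x) :: complex"
      \<comment> \<open>Along an edge \<open>F\<close> lifts through \<open>exp\<close> to a
        straight segment, whose endpoints give the winding number.\<close>
      have "winding_number (F \<circ> \<sigma> a b) 0 = winding_number (exp \<circ> linepath (?l a) (?l b)) 0"
      proof (rule winding_number_cong)
        fix t :: real assume "0 \<le> t" "t \<le> 1"
        then show "(F \<circ> \<sigma> a b) t = (exp \<circ> linepath (?l a) (?l b)) t"
          using \<sigma>_F[OF f r, of t] unfolding a_def b_def comp_def cis_conv_exp linepath_def
          by (simp add: algebra_simps scaleR_conv_of_real)
      qed
      also have "\<dots> = (?l b - ?l a) / (2 * of_real pi * \<i>)"
        by (subst winding_number_compose_exp) simp_all
      also have "\<dots> = of_int (W f b - W f a)"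
        by (simp add: field_simps)
      finally show ?thesis .
    qed
    ultimately show ?thesis unfolding a_def[symmetric] b_def[symmetric] by (simp add: algebra_simps)
  qed
  show thesis
  \<comment> \<open>At vertices of the patch \<open>N\<close> is a complex number known to be an
    integer; the floor of its real part only converts the type.\<close>
  proof (rule that[of "\<lambda>v. \<lfloor>Re (N v)\<rfloor>"])
    fix f r assume f: "f \<in> P" "r < (5::nat)"
    obtain i j where ij: "N (f ! r) = of_int i" "N (f ! (Suc r mod 5)) = of_int j"
      using N_int[OF f] N_int[OF f(1), of "Suc r mod 5"]
        by (metis Ints_cases mod_less_divisor zero_less_numeral)
    have "complex_of_int (j - i) = of_int (W f (f ! (Suc r mod 5)) - W f (f ! r))"
      using N_diff[OF f] unfolding ij by simp
    then have "j - i = W f (f ! (Suc r mod 5)) - W f (f ! r)" by (simp only: of_int_eq_iff)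
    then show "\<lfloor>Re (N (f ! (Suc r mod 5)))\<rfloor> - \<lfloor>Re (N (f ! r))\<rfloor> =
        W f (f ! (Suc r mod 5)) - W f (f ! r)"
      unfolding ij by simp
  qed
qed

lemma cocycle_coboundary:
  fixes u :: "vert \<Rightarrow> vert \<Rightarrow> int"
  assumes P: "finite P" "P \<subseteq> K_faces" and sc: "simply_connected (realization P)"
    and anti: "\<And>a b. u a b = - u b a"
    and cocycle: "\<And>f. f \<in> P \<Longrightarrow> (\<Sum>r<5. u (f ! r) (f ! (Suc r mod 5))) = 0"
  obtains y where "\<And>f r. f \<in> P \<Longrightarrow> r < 5 \<Longrightarrow>
      u (f ! r) (f ! (Suc r mod 5)) = y (f ! (Suc r mod 5)) - y (f ! r)"
proof -
  have D: "length f = 5 \<and> distinct f" if "f \<in> P" for f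
    using K_face_distinct that P by blast
  \<comment> \<open>The potential of \<open>f\<close> sums \<open>u\<close> along the boundary from
    the corner at position 0 up to \<open>v\<close>.\<close>
  define W where "W = (\<lambda>f v. \<Sum>s<(THE i. i < 5 \<and> f ! i = v). u (f ! s) (f ! (Suc s mod 5)))"
  have W: "W f (f ! i) = (\<Sum>s<i. u (f ! s) (f ! (Suc s mod 5)))" if "f \<in> P" "i < 5" for f i
  proof -
    have "(THE j. j < 5 \<and> f ! j = f ! i) = i"
      using D[OF that(1)] that(2) by (intro the_equality) (auto simp: nth_eq_iff_index_eq)
    then show ?thesis unfolding W_def by simp
  qed
  have W_diff: "W f (f ! (Suc r mod 5)) - W f (f ! r) = u (f ! r) (f ! (Suc r mod 5))"
    if f: "f \<in> P" and r: "r < 5" for f r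
  proof (cases "r = 4")
    case True
    \<comment> \<open>The edge from corner 4 back to corner 0 is where the cocycle condition
      enters.\<close>
    have "(\<Sum>s<Suc 4. u (f ! s) (f ! (Suc s mod 5))) = 0" using cocycle[OF f] by simp
    then have "(\<Sum>s<4. u (f ! s) (f ! (Suc s mod 5))) + u (f ! 4) (f ! (Suc 4 mod 5)) = 0"
      by (simp only: sum.lessThan_Suc)
    then show ?thesis using W[OF f, of 4] W[OF f, of 0] True by simp
  next
    case False
    then show ?thesis using W[OF f r] W[OF f, of "Suc r"] r by simp
  qed
  have "compatible_potentials P W"
    unfolding compatible_potentials_def
  proof (intro ballI allI impI)
    fix f g r s
    assume f: "f \<in> P" and g: "g \<in> P" and r: "r < (5::nat)" and s: "s < (5::nat)"
      and eq: "{f ! r, f ! (Suc r mod 5)} = {g ! s, g ! (Suc s mod 5)}"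
    consider "f ! r = g ! s" "f ! (Suc r mod 5) = g ! (Suc s mod 5)"
      | "f ! r = g ! (Suc s mod 5)" "f ! (Suc r mod 5) = g ! s"
      using eq by (metis doubleton_eq_iff)
    then show "W f (f ! (Suc r mod 5)) - W f (f ! r) = W g (f ! (Suc r mod 5)) - W g (f ! r)"
    proof cases
      case 1
      then show ?thesis using W_diff[OF f r] W_diff[OF g s] by simp
    next
      case 2
      show ?thesis
        using W_diff[OF f r] W_diff[OF g s] anti[of "f ! r" "f ! (Suc r mod 5)"]
        unfolding 2 by linarith
    qed
  qed
  then obtain y where "\<And>f r. f \<in> P \<Longrightarrow> r < 5 \<Longrightarrow>
      y (f ! (Suc r mod 5)) - y (f ! r) = W f (f ! (Suc r mod 5)) - W f (f ! r)"
    using potentials_glue[OF P(1) D sc] by metis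
  then show thesis using that W_diff by metis
qed

section \<open>Free actions of a cyclic group\<close>

text \<open>\<open>s\<close> is the indicator of a set of orbit representatives. Choosing from the
  orbit as a set makes all its points agree on the representative, and freeness lets one period meet
  it exactly once.\<close>

lemma orbit_indicator:
  fixes \<psi> :: "'a \<Rightarrow> 'a"
  assumes m: "0 < m" and closed: "\<And>x. x \<in> X \<Longrightarrow> \<psi> x \<in> X"
    and period: "\<And>x. x \<in> X \<Longrightarrow> (\<psi> ^^ m) x = x"
    and free: "\<And>x k. x \<in> X \<Longrightarrow> 0 < k \<Longrightarrow> k < m \<Longrightarrow> (\<psi> ^^ k) x \<noteq> x"
  obtains s :: "'a \<Rightarrow> int" where "\<And>x. x \<in> X \<Longrightarrow> (\<Sum>k<m. s ((\<psi> ^^ k) x)) = 1"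
proof -
  define orb where "orb = (\<lambda>x. (\<lambda>k. (\<psi> ^^ k) x) ` {..<m})"
  have X: "(\<psi> ^^ k) x \<in> X" if "x \<in> X" for k x
    using that by (induction k) (auto intro: closed)
  have step: "orb (\<psi> x) = orb x" if x: "x \<in> X" for x
  proof -
    obtain n where n: "m = Suc n" using m gr0_implies_Suc by blast
    have "orb (\<psi> x) = (\<lambda>k. (\<psi> ^^ Suc k) x) ` {..<m}"
      unfolding orb_def by (simp add: funpow_swap1)
    also have "\<dots> = insert ((\<psi> ^^ m) x) ((\<lambda>k. (\<psi> ^^ Suc k) x) ` {..<n})"
      unfolding n lessThan_Suc by simp
    also have "\<dots> = insert ((\<psi> ^^ 0) x) ((\<lambda>k. (\<psi> ^^ Suc k) x) ` {..<n})"
      using period[OF x] by simp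
    also have "\<dots> = orb x"
      unfolding orb_def n lessThan_Suc_eq_insert_0 by (simp only: image_insert image_image)
    finally show ?thesis .
  qed
  have orb: "orb ((\<psi> ^^ k) x) = orb x" if "x \<in> X" for x k
    using that step X by (induction k) auto
  define s where "s = (\<lambda>x. if x = (SOME y. y \<in> orb x) then 1 else (0::int))"
  show thesis
  proof (rule that)
    fix x assume x: "x \<in> X"
    have "(SOME y. y \<in> orb x) \<in> orb x"
      by (rule someI[of _ x]) (use m in \<open>force simp: orb_def\<close>)
    then obtain j where j: "j < m" "(SOME y. y \<in> orb x) = (\<psi> ^^ j) x"
      unfolding orb_def by blast
    have neq: "(\<psi> ^^ i) x \<noteq> (\<psi> ^^ k) x" if "i < k" "k < m" for i k
    proof -
      have "(\<psi> ^^ k) x = (\<psi> ^^ (k - i)) ((\<psi> ^^ i) x)"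
        using that by (metis add_diff_inverse_nat comp_apply funpow_add add.commute less_imp_le not_less)
      moreover have "k - i < m" "0 < k - i" using that by simp_all
      ultimately show ?thesis using free[OF X[OF x]] by metis
    qed
    have "s ((\<psi> ^^ k) x) = (if k = j then 1 else 0)" if "k < m" for k
      unfolding s_def orb[OF x] j(2) using neq[of k j] neq[of j k] j(1) that
      by (metis linorder_neqE_nat)
    then have "(\<Sum>k<m. s ((\<psi> ^^ k) x)) = (\<Sum>k<m. if k = j then 1 else 0)" by simp
    then show "(\<Sum>k<m. s ((\<psi> ^^ k) x)) = 1" using j(1) by simp
  qed
qed

lemma sum_shift_periodic:
  fixes c :: "nat \<Rightarrow> int"
  assumes "c m = c 0"
  shows "(\<Sum>k<m. c (Suc k)) = (\<Sum>k<m. c k)"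
  using sum_lessThan_telescope[of c m] assms by (simp add: sum_subtractf)

lemma cyclic_telescope: "(\<Sum>r<5. h (f ! (Suc r mod 5)) - h (f ! r)) = (0::int)"
  by (simp add: lessThan_nat_numeral lessThan_Suc numeral_2_eq_2)

text \<open>This is \<open>H\<^sup>1 = 0\<close> for a cyclic group acting on a free module: along one orbit, a function
  \<open>x\<close> of norm zero is the difference operator applied to the weighted partial sums.\<close>

lemma norm_zero_primitive:
  fixes x :: "nat \<Rightarrow> int" and \<sigma> :: "nat \<Rightarrow> int"
  assumes "(\<Sum>i<m. x i) = 0" "(\<Sum>k<m. \<sigma> (Suc k)) = 1"
  shows "(\<Sum>k<m. (\<Sum>i<k. x i) * \<sigma> k) - (\<Sum>k<m. (\<Sum>i<k. x (Suc i)) * \<sigma> (Suc k)) = x 0"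
proof -
  have "(\<Sum>i<k. x (Suc i)) = (\<Sum>i<Suc k. x i) - x 0" for k
    by (simp add: sum.lessThan_Suc_shift del: sum.lessThan_Suc)
  then have "(\<Sum>k<m. (\<Sum>i<k. x (Suc i)) * \<sigma> (Suc k)) =
      (\<Sum>k<m. (\<Sum>i<Suc k. x i) * \<sigma> (Suc k)) - x 0 * (\<Sum>k<m. \<sigma> (Suc k))"
    by (simp add: left_diff_distrib sum_subtractf sum_distrib_left)
  also have "(\<Sum>k<m. (\<Sum>i<Suc k. x i) * \<sigma> (Suc k)) = (\<Sum>k<m. (\<Sum>i<k. x i) * \<sigma> k)"
    by (rule sum_shift_periodic) (simp add: assms)
  finally show ?thesis using assms(2) by simp
qed

section \<open>Automorphisms of patches\<close>

lemma nth_5_cases: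
  assumes "length f = 5" "v \<in> set f"
  obtains r where "r < 5" "v = f ! r"
  using assms by (metis in_set_conv_nth)

lemma chain_connected_induct:
  assumes "chain_connected P" "f \<in> P" "g \<in> P" "Q f"
    and step: "\<And>h k. h \<in> P \<Longrightarrow> k \<in> P \<Longrightarrow> share_edge h k \<Longrightarrow> Q h \<Longrightarrow> Q k"
  shows "Q g"
proof -
  have "(\<lambda>x y. x \<in> P \<and> y \<in> P \<and> share_edge x y)\<^sup>*\<^sup>* f g"
    using assms(1-3) unfolding chain_connected_def by blast
  then show ?thesis
    by (induction rule: rtranclp_induct) (use assms(4) step in blast)+
qed

lemma share_edge_vertex:
  assumes "share_edge f g"
  obtains r s where "r < 5" "s < 5" "f ! r = g ! s"
proof -
  obtain r s where rs: "r < 5" "s < 5" "{f ! r, f ! ((r + 1) mod 5)} = {g ! s, g ! ((s + 1) mod 5)}"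
    using assms unfolding share_edge_def by blast
  then have "f ! r = g ! s \<or> f ! r = g ! ((s + 1) mod 5)" by blast
  then show thesis using that rs(1,2) by (metis mod_less_divisor zero_less_numeral)
qed

text \<open>Formulated for maps sending faces to faces, so that it covers every power of an
  automorphism. A fixed corner keeps its label and so fixes its face, which passes a fixed vertex on
  to each neighbour.\<close>

lemma patch_map_rigid:
  assumes P: "P \<subseteq> K_faces" "chain_connected P" and \<psi>: "\<And>f. f \<in> P \<Longrightarrow> map \<psi> f \<in> P"
    and v: "v \<in> patch_verts P" "\<psi> v = v" and w: "w \<in> patch_verts P"
  shows "\<psi> w = w"
proof -
  have len: "length f = 5" if "f \<in> P" for f using K_face_distinct that P(1) by blast
  have fix_face: "map \<psi> f = f" if "f \<in> P" "r < 5" "\<psi> (f ! r) = f ! r" for f r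
    using K_face_unique[of "map \<psi> f" f r] that \<psi>[OF that(1)] P(1) len by auto
  obtain f where f: "f \<in> P" "v \<in> set f" using v(1) unfolding patch_verts_def by blast
  obtain g where g: "g \<in> P" "w \<in> set g" using w unfolding patch_verts_def by blast
  have "map \<psi> f = f"
    using fix_face[OF f(1)] v(2) f(2) len[OF f(1)] by (metis nth_5_cases)
  with P(2) f(1) g(1) have "map \<psi> g = g"
  proof (rule chain_connected_induct)
    fix h k assume hk: "h \<in> P" "k \<in> P" "share_edge h k" "map \<psi> h = h"
    obtain r s where rs: "r < 5" "s < 5" "h ! r = k ! s" using share_edge_vertex[OF hk(3)] .
    have "\<psi> (h ! r) = h ! r" using hk(4) len[OF hk(1)] rs(1) by (metis nth_map)
    then show "map \<psi> k = k" using fix_face[OF hk(2) rs(2)] rs(3) by simp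
  qed
  then show ?thesis using g(2) by (metis map_eq_conv map_ident)
qed

theorem theoremt:
  fixes P :: "vert list set" and \<phi> :: "vert \<Rightarrow> vert"
  assumes "P \<subseteq> K_faces" and "finite P"
    and "simply_connected_patch P" and "chain_connected P"
    and "patch_automorphism P \<phi>"
  shows "\<forall>v\<in>patch_verts P. \<phi> v = v"
proof (cases "P = {}")
  case True
  then show ?thesis unfolding patch_verts_def by simp
next
  case False
  define V where "V = patch_verts P"
  have len: "length f = 5" if "f \<in> P" for f using K_face_distinct that assms(1) by blast
  have nthV: "f ! r \<in> V" if "f \<in> P" "r < 5" for f r
    using that len[OF that(1)] unfolding V_def patch_verts_def by (auto intro!: bexI[of _ f])
  have Vnth: "\<exists>f\<in>P. \<exists>r<5. v = f ! r" if "v \<in> V" for v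
    using that len nth_5_cases unfolding V_def patch_verts_def by (metis UN_E)
  have "finite V" unfolding V_def patch_verts_def using assms(2) by simp
  have face: "map \<phi> f \<in> P" if "f \<in> P" for f
    using assms(5) that unfolding patch_automorphism_def V_def by auto
  have bij: "bij_betw \<phi> V V" using assms(5) unfolding patch_automorphism_def V_def by blast
  have face_pow: "map (\<phi> ^^ k) f \<in> P" if "f \<in> P" for f k
  proof (induction k)
    case 0
    then show ?case using that by simp
  next
    case (Suc k)
    then show ?case using face[OF Suc] by (simp add: comp_def)
  qed
  have rigid: "(\<phi> ^^ k) w = w" if "v \<in> V" "(\<phi> ^^ k) v = v" "w \<in> V" for k v w
    using patch_map_rigid[OF assms(1,4), of "\<phi> ^^ k"] face_pow that unfolding V_def by blast
  have powV: "(\<phi> ^^ k) v \<in> V" if "v \<in> V" for k v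
    using that bij by (induction k) (auto simp: bij_betw_def)
  obtain v0 where v0: "v0 \<in> V" using False nthV[of _ 0] by auto

  \<comment> \<open>Two powers agree at \<open>v0\<close> because \<open>V\<close> is finite;
    rigidity then makes the power by their difference trivial on all of \<open>V\<close>.\<close>
  have "\<exists>m>0. \<forall>v\<in>V. (\<phi> ^^ m) v = v"
  proof -
    have "\<not> inj (\<lambda>k. (\<phi> ^^ k) v0)"
      using finite_subset[of "range (\<lambda>k. (\<phi> ^^ k) v0)" V] powV[OF v0] \<open>finite V\<close>
      by (metis (no_types, lifting) finite_imageD image_subsetI infinite_UNIV_nat)
    then obtain i j where ij: "i < j" "(\<phi> ^^ i) v0 = (\<phi> ^^ j) v0"
      unfolding inj_def by (metis linorder_neqE_nat)
    have "(\<phi> ^^ j) v0 = (\<phi> ^^ (j - i)) ((\<phi> ^^ i) v0)"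
      using ij(1) by (metis comp_apply funpow_add le_add_diff_inverse2 less_imp_le)
    then have "(\<phi> ^^ (j - i)) ((\<phi> ^^ i) v0) = (\<phi> ^^ i) v0" using ij(2) by simp
    then have "\<forall>v\<in>V. (\<phi> ^^ (j - i)) v = v" using rigid[OF powV[OF v0]] by blast
    then show ?thesis using ij(1) by (intro exI[of _ "j - i"]) simp
  qed
  then obtain m where m: "0 < m" "\<And>v. v \<in> V \<Longrightarrow> (\<phi> ^^ m) v = v"
    and least: "\<And>k. 0 < k \<Longrightarrow> k < m \<Longrightarrow> \<not> (\<forall>v\<in>V. (\<phi> ^^ k) v = v)"
    using exists_least_iff[of "\<lambda>m. 0 < m \<and> (\<forall>v\<in>V. (\<phi> ^^ m) v = v)"] by blast
  have free: "(\<phi> ^^ k) v \<noteq> v" if "v \<in> V" "0 < k" "k < m" for v k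
    using rigid[OF that(1)] least[OF that(2,3)] by blast

  define E where "E = {{f ! r, f ! (Suc r mod 5)} | f r. f \<in> P \<and> r < 5}"
  have image_pow: "((`) \<phi> ^^ k) e = (\<phi> ^^ k) ` e" for k e
    by (induction k) (auto simp: image_comp)
  have E_face: "{\<phi> (f ! r), \<phi> (f ! (Suc r mod 5))} \<in> E" if "f \<in> P" "r < 5" for f r
    using face[OF that(1)] that len[OF that(1)] unfolding E_def
    by (intro CollectI exI[of _ "map \<phi> f"] exI[of _ r]) simp
  obtain s :: "vert \<Rightarrow> int" where s: "\<And>v. v \<in> V \<Longrightarrow> (\<Sum>k<m. s ((\<phi> ^^ k) v)) = 1"
    using orbit_indicator[of m V \<phi>] m free powV[of _ 1] by auto
  \<comment> \<open>The weights live on unordered edges, so that the 1-cochain \<open>u\<close>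
    built from them is antisymmetric.\<close>
  obtain \<sigma> :: "vert set \<Rightarrow> int" where \<sigma>: "\<And>e. e \<in> E \<Longrightarrow> (\<Sum>k<m. \<sigma> (((`) \<phi> ^^ k) e)) = 1"
  proof (rule orbit_indicator[of m E "(`) \<phi>"])
    fix e assume "e \<in> E"
    then obtain f r where e: "f \<in> P" "r < 5" "e = {f ! r, f ! (Suc r mod 5)}" unfolding E_def
      by blast
    show "\<phi> ` e \<in> E" using E_face[OF e(1,2)] e(3) by simp
    have V: "f ! r \<in> V" "f ! (Suc r mod 5) \<in> V" using nthV[OF e(1)] e(2) by simp_all
    show "((`) \<phi> ^^ m) e = e" unfolding image_pow e(3) using m(2) V by simp
    fix k assume k: "0 < k" "k < m"
    show "((`) \<phi> ^^ k) e \<noteq> e"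
    proof
      assume "((`) \<phi> ^^ k) e = e"
      then have "(\<phi> ^^ k) (f ! r) = f ! (Suc r mod 5)" "(\<phi> ^^ k) (f ! (Suc r mod 5)) = f ! r"
        using free[OF V(1) k] free[OF V(2) k] unfolding image_pow e(3)
          by (auto simp: doubleton_eq_iff)
      \<comment> \<open>The image face would run through this edge backwards under the same label
        \<open>r\<close>, whereas the labels on the two sides of an edge differ.\<close>
      then show False
        using K_face_reversed_edge[of "map (\<phi> ^^ k) f" f r r] face_pow[OF e(1), of k] e(1,2) assms(1) len[OF e(1)]
        by auto
    qed
  qed (use m in auto)

  define x where "x = (\<lambda>a b i. s ((\<phi> ^^ i) b) - s ((\<phi> ^^ i) a))"
  \<comment> \<open>\<open>norm_zero_primitive\<close> inverts 1 - \<phi>; the minus sign makes it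
    \<phi> - 1.\<close>
  define u where "u = (\<lambda>a b. - (\<Sum>k<m. (\<Sum>i<k. x a b i) * \<sigma> {(\<phi> ^^ k) a, (\<phi> ^^ k) b}))"
  define du where "du = (\<lambda>f. \<Sum>r<5. u (f ! r) (f ! (Suc r mod 5)))"
  have u_anti: "u a b = - u b a" for a b
  proof -
    have "(\<Sum>i<k. x a b i) = - (\<Sum>i<k. x b a i)" for k
      unfolding x_def sum_negf[symmetric] by simp
    then show ?thesis unfolding u_def by (simp add: sum_negf insert_commute)
  qed
  have Tu: "u (\<phi> (f ! r)) (\<phi> (f ! (Suc r mod 5))) - u (f ! r) (f ! (Suc r mod 5)) =
      s (f ! (Suc r mod 5)) - s (f ! r)" if "f \<in> P" "r < 5" for f r
  proof -
    define a b where "a = f ! r" and "b = f ! (Suc r mod 5)"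
    have V: "a \<in> V" "b \<in> V" using nthV[OF that(1)] that(2) unfolding a_def b_def by simp_all
    have sh: "(\<phi> ^^ k) (\<phi> c) = (\<phi> ^^ Suc k) c" for k c by (simp add: funpow_swap1)
    have "(\<Sum>k<m. (\<Sum>i<k. x a b i) * \<sigma> {(\<phi> ^^ k) a, (\<phi> ^^ k) b}) -
      (\<Sum>k<m. (\<Sum>i<k. x a b (Suc i)) * \<sigma> {(\<phi> ^^ Suc k) a, (\<phi> ^^ Suc k) b}) = x a b 0"
    proof (rule norm_zero_primitive)
      show "(\<Sum>i<m. x a b i) = 0"
        using s V unfolding x_def by (simp add: sum_subtractf)
      have "(\<Sum>k<m. \<sigma> (((`) \<phi> ^^ k) {\<phi> a, \<phi> b})) = 1"
        using \<sigma> E_face[OF that] unfolding a_def b_def by blast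
      then show "(\<Sum>k<m. \<sigma> {(\<phi> ^^ Suc k) a, (\<phi> ^^ Suc k) b}) = 1"
        unfolding image_pow by (simp add: funpow_swap1)
    qed
    then have "u (\<phi> a) (\<phi> b) - u a b = x a b 0"
      unfolding u_def x_def sh by simp
    then show ?thesis unfolding x_def a_def b_def by simp
  qed
  \<comment> \<open>The coboundary of (\<phi> - 1) u is that of \<delta>s, a telescoping sum around
    the face.\<close>
  have du_step: "du (map \<phi> f) = du f" if "f \<in> P" for f
  proof -
    have "du (map \<phi> f) - du f = (\<Sum>r<5. s (f ! (Suc r mod 5)) - s (f ! r))"
      unfolding du_def sum_subtractf[symmetric]
      using Tu[OF that] len[OF that] by (intro sum.cong) simp_all
    then show ?thesis using cyclic_telescope[of s f] by simp
  qed
  have du_pow: "du (map (\<phi> ^^ k) f) = du f" if "f \<in> P" for f k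
  proof (induction k)
    case 0
    then show ?case by simp
  next
    case (Suc k)
    have "map (\<phi> ^^ Suc k) f = map \<phi> (map (\<phi> ^^ k) f)" by simp
    then show ?case using du_step[OF face_pow[OF that]] Suc by metis
  qed

  \<comment> \<open>A face is weighted by \<open>s\<close> at its corner of label 0, which \<phi>
    carries along with the face. The weights sum to 1 over a period and \<open>du\<close> is
    constant there, so the norm of the weighted cochain is \<open>du\<close>.\<close>
  obtain v :: "vert \<Rightarrow> vert \<Rightarrow> int" where v: "\<And>a b. v a b = - v b a"
    "\<And>f. f \<in> P \<Longrightarrow> (\<Sum>r<5. v (f ! r) (f ! (Suc r mod 5))) = du f * s (f ! 0)"
    using coboundary_surj[OF assms(2,1), of "\<lambda>f. du f * s (f ! 0)"] by blast
  define Nv where "Nv = (\<lambda>a b. \<Sum>k<m. v ((\<phi> ^^ k) a) ((\<phi> ^^ k) b))"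
  have dNv: "(\<Sum>r<5. Nv (f ! r) (f ! (Suc r mod 5))) = du f" if "f \<in> P" for f
  proof -
    have "(\<Sum>r<5. v ((\<phi> ^^ k) (f ! r)) ((\<phi> ^^ k) (f ! (Suc r mod 5)))) = du f * s ((\<phi> ^^ k) (f ! 0))"
        for k
    proof -
      have "(\<Sum>r<5. v (map (\<phi> ^^ k) f ! r) (map (\<phi> ^^ k) f ! (Suc r mod 5))) =
          du f * s (map (\<phi> ^^ k) f ! 0)"
        using v(2)[OF face_pow[OF that]] du_pow[OF that] by simp
      then show ?thesis using len[OF that] by simp
    qed
    then have "(\<Sum>r<5. Nv (f ! r) (f ! (Suc r mod 5))) = (\<Sum>k<m. du f * s ((\<phi> ^^ k) (f ! 0)))"
      unfolding Nv_def by (subst sum.swap) simp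
    also have "\<dots> = du f"
      using s[OF nthV[OF that, of 0]] by (simp add: sum_distrib_left[symmetric])
    finally show ?thesis .
  qed
  have Nv_inv: "Nv (\<phi> a) (\<phi> b) = Nv a b" if "a \<in> V" "b \<in> V" for a b
    using sum_shift_periodic[of "\<lambda>k. v ((\<phi> ^^ k) a) ((\<phi> ^^ k) b)" m] m(2) that
    unfolding Nv_def by (simp add: funpow_swap1)

  obtain y where y: "\<And>f r. f \<in> P \<Longrightarrow> r < 5 \<Longrightarrow>
      u (f ! r) (f ! (Suc r mod 5)) - Nv (f ! r) (f ! (Suc r mod 5)) = y (f ! (Suc r mod 5)) - y (f ! r)"
  proof (rule cocycle_coboundary[OF assms(2,1), of "\<lambda>a b. u a b - Nv a b"])
    show "simply_connected (realization P)" using assms(3) unfolding simply_connected_patch_def .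
    show "u a b - Nv a b = - (u b a - Nv b a)" for a b
    proof -
      have "Nv a b = - Nv b a" unfolding Nv_def sum_negf[symmetric] by (rule sum.cong[OF refl v(1)])
      then show ?thesis using u_anti[of a b] by linarith
    qed
    show "(\<Sum>r<5. u (f ! r) (f ! (Suc r mod 5)) - Nv (f ! r) (f ! (Suc r mod 5))) = 0"
        if "f \<in> P" for f
      using dNv[OF that] unfolding du_def by (simp add: sum_subtractf)
  qed blast
  define z where "z = (\<lambda>a. s a - (y (\<phi> a) - y a))"
  \<comment> \<open>Norms are invariant, so applying \<phi> - 1 to u - N v = \<delta>y leaves
    \<delta>s = (\<phi> - 1) \<delta>y.\<close>
  have z_edge: "z (f ! (Suc r mod 5)) = z (f ! r)" if f: "f \<in> P" and r: "r < 5" for f r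
  proof -
    have "u (\<phi> (f ! r)) (\<phi> (f ! (Suc r mod 5))) - Nv (\<phi> (f ! r)) (\<phi> (f ! (Suc r mod 5))) =
        y (\<phi> (f ! (Suc r mod 5))) - y (\<phi> (f ! r))"
      using y[OF face[OF f] r] len[OF f] r by simp
    then show ?thesis
      using y[OF f r] Tu[OF f r] Nv_inv[OF nthV[OF f r] nthV[OF f, of "Suc r mod 5"]]
      unfolding z_def by simp
  qed
  have z_face: "z (f ! r) = z (f ! 0)" if "f \<in> P" "r < 5" for f r
    using that(2)
  proof (induction r)
    case (Suc r)
    then show ?case using z_edge[OF that(1), of r] by simp
  qed simp
  have z_const: "z a = z b" if a: "a \<in> V" and b: "b \<in> V" for a b
  proof -
    obtain f r g r' where f: "f \<in> P" "r < 5" "a = f ! r" and g: "g \<in> P" "r' < 5" "b = g ! r'"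
      using Vnth[OF a] Vnth[OF b] by blast
    have "z (g ! 0) = z (f ! 0)"
    proof (rule chain_connected_induct[OF assms(4) f(1) g(1)])
      fix h k assume hk: "h \<in> P" "k \<in> P" "share_edge h k" "z (h ! 0) = z (f ! 0)"
      obtain r s where "r < 5" "s < 5" "h ! r = k ! s" using share_edge_vertex[OF hk(3)] .
      then show "z (k ! 0) = z (f ! 0)" using z_face[OF hk(1), of r] z_face[OF hk(2), of s] hk(4)
        by simp
    qed simp
    then show ?thesis using z_face[OF f(1,2)] z_face[OF g(1,2)] f(3) g(3) by simp
  qed
  \<comment> \<open>Over a full period the terms in \<open>y\<close> cancel and \<open>s\<close>
    contributes 1.\<close>
  have "(\<Sum>k<m. z ((\<phi> ^^ k) v0)) = 1"
    using sum_shift_periodic[of "\<lambda>k. y ((\<phi> ^^ k) v0)" m] m(2)[OF v0] s[OF v0]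
    unfolding z_def by (simp add: sum_subtractf)
  moreover have "(\<Sum>k<m. z ((\<phi> ^^ k) v0)) = (\<Sum>k<m. z v0)"
    by (rule sum.cong[OF refl z_const[OF powV[OF v0] v0]])
  ultimately have "int m * z v0 = 1" by simp
  then have "m = 1" by (simp add: zmult_eq_1_iff)
  then show ?thesis using m(2) unfolding V_def by simp
qed

end
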